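(* Let $\mathcal A$ be a $\mathcal B(\mathcal H,\mathcal K)$-valued frame for $\mathcal H$ with lower frame bound $\alpha$ and let $\mathcal B$ be a $\mu$-perturbation of $\mathcal A$, where $0<\mu<\sqrt{\alpha}$. Then $\mathcal B$ is an operator-valued frame for $\mathcal H$, and for each $L\in\mathcal L_{\mathcal A}$ the dual $\widetilde{\mathcal B}_L:=\widetilde{\mathcal B}(P_{\ker T_{\mathcal B}^*}T_{\widetilde{\mathcal A}(L)})$ of $\mathcal B$ is a best approximation of $\widetilde{\mathcal A}(L)$ among the duals of $\mathcal B$, i.e. $$\|T_{\widetilde{\mathcal B}_L}-T_{\widetilde{\mathcal A}(L)}\|\le\|T_{\mathcal C}-T_{\widetilde{\mathcal A}(L)}\|\quad\text{for every dual }\mathcal C\text{ of }\mathcal B,$$ and $\widetilde{\mathcal B}_L$ is a $\lambda$-perturbation of $\widetilde{\mathcal A}(L)$, where $$\lambda=\frac{\mu}{\sqrt{\alpha}-\mu}\left(\frac{1}{\sqrt{\alpha}}+\|L\|\right).$$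
   Context: $\mathcal H,\mathcal K$ are Hilbert spaces, $I\subset\mathbb N$ is a finite or countable index set, and $\mathfrak K:=\ell^2(I,\mathcal K)$ is the Hilbert space of square-summable $\mathcal K$-valued sequences. $\mathcal B(X,Y)$ denotes the bounded everywhere defined linear operators $X\to Y$, with the operator norm; $P_V$ is the orthogonal projection onto a closed subspace $V$. A sequence $\mathcal A=(A_i)_{i\in I}\subset\mathcal B(\mathcal H,\mathcal K)$ is a $\mathcal B(\mathcal H,\mathcal K)$-valued Bessel sequence if there is $\beta>0$ with $\sum_{i\in I}\|A_ix\|^2\le\beta\|x\|^2$ for all $x\in\mathcal H$. The analysis operator is $T_{\mathcal A}\in\mathcal B(\mathcal H,\mathfrak K)$, $T_{\mathcal A}x=(A_ix)_{i\in I}$, and the frame operator is $S_{\mathcal A}:=T_{\mathcal A}^*T_{\mathcal A}$. The map $\mathcal A\mapsto T_{\mathcal A}$ is a bijection from Bessel sequences onto $\mathcal B(\mathcal H,\mathfrak K)$. $\mathcal A$ is a $\mathcal B(\mathcal H,\mathcal K)$-valued (operator-valued) frame for $\mathcal H$ with lower and upper frame bounds $\alpha,\beta>0$ if $\overline{\operatorname{span}}\{\operatorname{ran}A_i^*:i\in I\}=\mathcal H$ and $\alpha\|x\|^2\le\sum_{i\in I}\|A_ix\|^2\le\beta\|x\|^2$ for all $x\in\mathcal H$; then $S_{\mathcal A}$ is boundedly invertible. A dual of an operator-valued frame $\mathcal A$ for $\mathcal H$ is a $\mathcal B(\mathcal H,\mathcal K)$-valued Bessel sequence $\widetilde{\mathcal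 A}=(\widetilde A_i)_{i\in I}$ with $\sum_{i\in I}\widetilde A_i^*A_ix=x$ for all $x\in\mathcal H$, i.e. $T_{\widetilde{\mathcal A}}^*T_{\mathcal A}=I$. Put $\mathcal L_{\mathcal A}:=\{L\in\mathcal B(\mathcal H,\mathfrak K): T_{\mathcal A}^*L=0\}$. For $L\in\mathcal L_{\mathcal A}$, $\widetilde{\mathcal A}(L)$ denotes the dual of $\mathcal A$ with analysis operator $T_{\widetilde{\mathcal A}(L)}=T_{\mathcal A}S_{\mathcal A}^{-1}+L$. The same notation is used for $\mathcal B$. For $\mu>0$, a $\mathcal B(\mathcal H,\mathcal K)$-valued Bessel sequence $\mathcal B$ is a $\mu$-perturbation of the $\mathcal B(\mathcal H,\mathcal K)$-valued Bessel sequence $\mathcal A$ if $\|T_{\mathcal A}-T_{\mathcal B}\|\le\mu$. *)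

theory Defs
  imports "HOL-Analysis.Analysis"
begin

section \<open>Scalars: the real or the complex numbers\<close>

text \<open>
  Up to isomorphism the only instances are the real numbers with trivial conjugation and the
  complex numbers: by the last axiom and additivity, \<open>x + conjugate x\<close> and \<open>x * conjugate x\<close> are
  real, so every element is a root of a quadratic polynomial with real coefficients.
\<close>

class rc_field = real_normed_field + banach +
  fixes conjugate :: "'a \<Rightarrow> 'a"
  assumes conjugate_add: "conjugate (x + y) = conjugate x + conjugate y"
    and conjugate_mult: "conjugate (x * y) = conjugate x * conjugate y"
    and mult_conjugate: "x * conjugate x = (norm x)\<^sup>2 *\<^sub>R 1"

instantiation real :: rc_field
begin
definition conjugate_real :: "real \<Rightarrow> real" where "conjugate_real x = x"
instance by standard (auto simp: conjugate_real_def power2_eq_square)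
end

instantiation complex :: rc_field
begin
definition conjugate_complex :: "complex \<Rightarrow> complex" where "conjugate_complex = cnj"
instance
  by standard (simp_all add: conjugate_complex_def scaleR_conv_of_real complex_norm_square
      del: of_real_power)
end


section \<open>Hilbert spaces over the scalar field\<close>

text \<open>
  The vectors form a complete real normed type; the record carries the scalar multiplication and
  the scalar-valued inner product (linear in the first argument) inducing the norm of the type.
\<close>

record ('f, 'a) hilbert =
  scl :: "'f \<Rightarrow> 'a \<Rightarrow> 'a"
  ip :: "'a \<Rightarrow> 'a \<Rightarrow> 'f"

locale hilbert_space = vector_space "scl H"
  for H :: "('f::rc_field, 'a::banach) hilbert" +
  assumes scl_of_real: "scl H (of_real r) x = r *\<^sub>R x"
    and ip_add: "ip H (x + y) z = ip H x z + ip H y z"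
    and ip_scl: "ip H (scl H c x) y = c * ip H x y"
    and ip_conjugate: "ip H y x = conjugate (ip H x y)"
    and ip_self: "ip H x x = of_real ((norm x)\<^sup>2)"

text \<open>Real-linearity and boundedness are part of the type of \<open>T\<close>.\<close>

definition bops :: "('f, 'a::real_normed_vector) hilbert \<Rightarrow> ('f, 'b::real_normed_vector) hilbert
    \<Rightarrow> ('a \<Rightarrow>\<^sub>L 'b) set" where
  "bops X Y = {T :: 'a \<Rightarrow>\<^sub>L 'b. \<forall>c x. T (scl X c x) = scl Y c (T x)}"

definition adj :: "('f, 'a::real_normed_vector) hilbert \<Rightarrow> ('f, 'b::real_normed_vector) hilbert
    \<Rightarrow> ('a \<Rightarrow>\<^sub>L 'b) \<Rightarrow> ('b \<Rightarrow>\<^sub>L 'a)" where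
  "adj X Y T = Blinfun (\<lambda>y. THE z. \<forall>x. ip Y (T x) y = ip X x z)"

definition orth_proj :: "('f::zero, 'a::real_normed_vector) hilbert \<Rightarrow> 'a set \<Rightarrow> ('a \<Rightarrow>\<^sub>L 'a)" where
  "orth_proj X V = Blinfun (\<lambda>x. THE p. p \<in> V \<and> (\<forall>v\<in>V. ip X (x - p) v = 0))"

definition blinfun_inv :: "('a::real_normed_vector \<Rightarrow>\<^sub>L 'b::real_normed_vector) \<Rightarrow> ('b \<Rightarrow>\<^sub>L 'a)" where
  "blinfun_inv T = Blinfun (inv (blinfun_apply T))"


section \<open>Square-summable sequences\<close>

typedef (overloaded) ('k::real_normed_vector) ell2 =
  "{f :: nat \<Rightarrow> 'k. (\<lambda>i. (norm (f i))\<^sup>2) summable_on UNIV}"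
  morphisms seq Abs_ell2
  by (rule exI[of _ "\<lambda>_. 0"]) simp

setup_lifting type_definition_ell2

lemma sq_summable_add:
  fixes f g :: "nat \<Rightarrow> 'k::real_normed_vector"
  assumes f: "(\<lambda>i. (norm (f i))\<^sup>2) summable_on UNIV" and g: "(\<lambda>i. (norm (g i))\<^sup>2) summable_on UNIV"
  shows "(\<lambda>i. (norm (f i + g i))\<^sup>2) summable_on UNIV"
    and "sqrt (\<Sum>\<^sub>\<infinity>i. (norm (f i + g i))\<^sup>2)
      \<le> sqrt (\<Sum>\<^sub>\<infinity>i. (norm (f i))\<^sup>2) + sqrt (\<Sum>\<^sub>\<infinity>i. (norm (g i))\<^sup>2)"
proof -
  let ?c = "sqrt (\<Sum>\<^sub>\<infinity>i. (norm (f i))\<^sup>2) + sqrt (\<Sum>\<^sub>\<infinity>i. (norm (g i))\<^sup>2)"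
  have le: "L2_set (\<lambda>i. norm (h i)) F \<le> sqrt (\<Sum>\<^sub>\<infinity>i. (norm (h i))\<^sup>2)"
    if "(\<lambda>i. (norm (h i))\<^sup>2) summable_on UNIV" "finite F" for F and h :: "nat \<Rightarrow> 'k"
    unfolding L2_set_def using that by (auto intro!: finite_sum_le_infsum)
  have fin: "(\<Sum>i\<in>F. (norm (f i + g i))\<^sup>2) \<le> ?c\<^sup>2" if F: "finite F" for F
  proof -
    have "L2_set (\<lambda>i. norm (f i + g i)) F \<le> L2_set (\<lambda>i. norm (f i) + norm (g i)) F"
      by (intro L2_set_mono) (auto intro: norm_triangle_ineq)
    also have "\<dots> \<le> L2_set (\<lambda>i. norm (f i)) F + L2_set (\<lambda>i. norm (g i)) F"
      by (rule L2_set_triangle_ineq)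
    also have "\<dots> \<le> ?c" using le[OF f F] le[OF g F] by linarith
    finally have "(L2_set (\<lambda>i. norm (f i + g i)) F)\<^sup>2 \<le> ?c\<^sup>2"
      by (intro power_mono) auto
    then show ?thesis by (simp add: L2_set_def sum_nonneg)
  qed
  show s: "(\<lambda>i. (norm (f i + g i))\<^sup>2) summable_on UNIV"
    by (rule nonneg_bounded_partial_sums_imp_summable_on[where C = "?c\<^sup>2"])
       (auto simp: fin intro!: eventually_finite_subsets_at_top_weakI)
  have "(\<Sum>\<^sub>\<infinity>i. (norm (f i + g i))\<^sup>2) \<le> ?c\<^sup>2"
    by (rule infsum_le_finite_sums[OF s]) (rule fin)
  moreover have "0 \<le> ?c" by (simp add: infsum_nonneg)
  ultimately show "sqrt (\<Sum>\<^sub>\<infinity>i. (norm (f i + g i))\<^sup>2) \<le> ?c"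
    by (rule real_le_lsqrt[rotated])
qed

instantiation ell2 :: (real_normed_vector) real_normed_vector
begin

lift_definition zero_ell2 :: "'a ell2" is "\<lambda>_. 0" by simp
lift_definition uminus_ell2 :: "'a ell2 \<Rightarrow> 'a ell2" is "\<lambda>f i. - f i" by simp
lift_definition plus_ell2 :: "'a ell2 \<Rightarrow> 'a ell2 \<Rightarrow> 'a ell2" is "\<lambda>f g i. f i + g i"
  by (rule sq_summable_add)
lift_definition minus_ell2 :: "'a ell2 \<Rightarrow> 'a ell2 \<Rightarrow> 'a ell2" is "\<lambda>f g i. f i - g i"
  subgoal for f g using sq_summable_add(1)[of f "\<lambda>i. - g i"] by simp
  done
lift_definition scaleR_ell2 :: "real \<Rightarrow> 'a ell2 \<Rightarrow> 'a ell2" is "\<lambda>r f i. r *\<^sub>R f i"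
  by (auto simp: power_mult_distrib intro: summable_on_cmult_right)
lift_definition norm_ell2 :: "'a ell2 \<Rightarrow> real" is "\<lambda>f. sqrt (\<Sum>\<^sub>\<infinity>i. (norm (f i))\<^sup>2)" .
definition dist_ell2 :: "'a ell2 \<Rightarrow> 'a ell2 \<Rightarrow> real" where "dist_ell2 x y = norm (x - y)"
definition sgn_ell2 :: "'a ell2 \<Rightarrow> 'a ell2" where "sgn_ell2 x = inverse (norm x) *\<^sub>R x"
definition uniformity_ell2 :: "('a ell2 \<times> 'a ell2) filter" where
  "uniformity_ell2 = (INF e\<in>{0<..}. principal {(x, y). dist x y < e})"
definition open_ell2 :: "'a ell2 set \<Rightarrow> bool" where
  "open_ell2 U \<longleftrightarrow> (\<forall>x\<in>U. \<forall>\<^sub>F (x', y) in uniformity. x' = x \<longrightarrow> y \<in> U)"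

instance
proof
  fix x y :: "'a ell2" and r :: real
  show "norm x = 0 \<longleftrightarrow> x = 0"
  proof transfer
    fix f :: "nat \<Rightarrow> 'a" assume f: "(\<lambda>i. (norm (f i))\<^sup>2) summable_on UNIV"
    have "f i = 0" if "(\<Sum>\<^sub>\<infinity>i. (norm (f i))\<^sup>2) = 0" for i
      using nonneg_infsum_le_0D[of "\<lambda>i. (norm (f i))\<^sup>2" UNIV i] f that by simp
    then show "sqrt (\<Sum>\<^sub>\<infinity>i. (norm (f i))\<^sup>2) = 0 \<longleftrightarrow> f = (\<lambda>_. 0)" by auto
  qed
  show "norm (x + y) \<le> norm x + norm y" by transfer (rule sq_summable_add)
  show "norm (r *\<^sub>R x) = \<bar>r\<bar> * norm x"
    by transfer (simp add: power_mult_distrib infsum_cmult_right' real_sqrt_mult)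
qed (rule dist_ell2_def sgn_ell2_def uniformity_ell2_def open_ell2_def
     | (transfer, simp add: algebra_simps))+

end

text \<open>\<open>\<ell>\<^sup>2(I, K)\<close> is the subspace \<open>ell2_on I\<close> of \<open>\<ell>\<^sup>2(\<nat>, K)\<close>, sequences being extended by zero.\<close>

definition ell2 :: "('f::{comm_monoid_add, t2_space}, 'k::real_normed_vector) hilbert \<Rightarrow> ('f, 'k ell2) hilbert"
  where "ell2 K = \<lparr>scl = (\<lambda>c f. Abs_ell2 (\<lambda>i. scl K c (seq f i))),
                   ip = (\<lambda>f g. \<Sum>\<^sub>\<infinity>i. ip K (seq f i) (seq g i))\<rparr>"

definition ell2_on :: "nat set \<Rightarrow> 'k::real_normed_vector ell2 set" where
  "ell2_on I = {f. \<forall>i. i \<notin> I \<longrightarrow> seq f i = 0}"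


section \<open>Operator-valued Bessel sequences and frames\<close>

text \<open>Families over \<open>I\<close> are total functions on \<open>nat\<close> whose values outside \<open>I\<close> are never used.\<close>

type_synonym ('h, 'k) opseq = "nat \<Rightarrow> 'h \<Rightarrow>\<^sub>L 'k"

definition bessel_seq :: "('f, 'h::real_normed_vector) hilbert \<Rightarrow> ('f, 'k::real_normed_vector) hilbert
    \<Rightarrow> nat set \<Rightarrow> ('h, 'k) opseq \<Rightarrow> bool" where
  "bessel_seq H K I A \<longleftrightarrow> (\<forall>i\<in>I. A i \<in> bops H K) \<and>
     (\<exists>\<beta>>0. \<forall>x. (\<lambda>i. (norm (A i x))\<^sup>2) summable_on I \<and>
                (\<Sum>\<^sub>\<infinity>i\<in>I. (norm (A i x))\<^sup>2) \<le> \<beta> * (norm x)\<^sup>2)"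

definition analysis_op :: "nat set \<Rightarrow> ('h::real_normed_vector, 'k::real_normed_vector) opseq
    \<Rightarrow> ('h \<Rightarrow>\<^sub>L 'k ell2)" where
  "analysis_op I A = Blinfun (\<lambda>x. Abs_ell2 (\<lambda>i. if i \<in> I then A i x else 0))"

lemma bessel_seq_analysis_op:
  assumes A: "bessel_seq H K I A"
  shows "seq (analysis_op I A x) i = (if i \<in> I then A i x else 0)"
proof -
  obtain b where b: "b > 0" and s: "\<And>x. (\<lambda>i. (norm (A i x))\<^sup>2) summable_on I"
    and le: "\<And>x. (\<Sum>\<^sub>\<infinity>i\<in>I. (norm (A i x))\<^sup>2) \<le> b * (norm x)\<^sup>2"
    using A by (auto simp: bessel_seq_def)
  let ?f = "\<lambda>x i. if i \<in> I then A i x else 0"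
  have "(\<lambda>i. (norm (?f x i))\<^sup>2) summable_on UNIV" for x
    using s[of x] by (rule summable_on_cong_neutral[THEN iffD1, rotated 3]) auto
  then have seq: "seq (Abs_ell2 (?f x)) = ?f x" for x
    by (simp add: Abs_ell2_inverse)
  have "bounded_linear (\<lambda>x. Abs_ell2 (?f x))"
  proof (rule bounded_linear_intro[where K = "sqrt b"])
    fix x y and r :: real
    show "Abs_ell2 (?f (x + y)) = Abs_ell2 (?f x) + Abs_ell2 (?f y)"
      by (auto simp: seq_inject[symmetric] plus_ell2.rep_eq seq blinfun.add_right)
    show "Abs_ell2 (?f (r *\<^sub>R x)) = r *\<^sub>R Abs_ell2 (?f x)"
      by (auto simp: seq_inject[symmetric] scaleR_ell2.rep_eq seq blinfun.scaleR_right)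
    have "(\<Sum>\<^sub>\<infinity>i. (norm (?f x i))\<^sup>2) = (\<Sum>\<^sub>\<infinity>i\<in>I. (norm (A i x))\<^sup>2)"
      by (rule infsum_cong_neutral) auto
    then have "norm (Abs_ell2 (?f x)) \<le> sqrt (b * (norm x)\<^sup>2)"
      using le[of x] by (simp add: norm_ell2.rep_eq seq)
    then show "norm (Abs_ell2 (?f x)) \<le> norm x * sqrt b"
      by (simp add: real_sqrt_mult mult.commute)
  qed
  then show ?thesis
    by (simp add: analysis_op_def bounded_linear_Blinfun_apply seq)
qed

text \<open>The inverse of \<open>A \<mapsto> T\<^sub>A\<close>.\<close>

definition opseq_of :: "('h::real_normed_vector \<Rightarrow>\<^sub>L 'k::real_normed_vector ell2) \<Rightarrow> ('h, 'k) opseq" where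
  "opseq_of T = (\<lambda>i. Blinfun (\<lambda>x. seq (T x) i))"

lemma opseq_of_apply:
  fixes T :: "'h::real_normed_vector \<Rightarrow>\<^sub>L 'k::real_normed_vector ell2"
  shows "opseq_of T i x = seq (T x) i"
proof -
  have "norm (seq f i) \<le> norm f" for f :: "'k ell2"
  proof -
    have "(\<Sum>j\<in>{i}. (norm (seq f j))\<^sup>2) \<le> (\<Sum>\<^sub>\<infinity>j. (norm (seq f j))\<^sup>2)"
      using seq[of f] by (intro finite_sum_le_infsum) auto
    then show ?thesis by (simp add: norm_ell2.rep_eq real_le_rsqrt)
  qed
  then have "bounded_linear (\<lambda>f :: 'k ell2. seq f i)"
    by (intro bounded_linear_intro[where K = 1]) (auto simp: plus_ell2.rep_eq scaleR_ell2.rep_eq)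
  then have "bounded_linear (\<lambda>x. seq (T x) i)"
    by (rule bounded_linear_compose[OF _ blinfun.bounded_linear_right])
  then show ?thesis by (simp add: opseq_of_def bounded_linear_Blinfun_apply)
qed

lemma analysis_op_opseq_of:
  fixes T :: "'h::real_normed_vector \<Rightarrow>\<^sub>L 'k::real_normed_vector ell2"
  assumes "range T \<subseteq> ell2_on I"
  shows "analysis_op I (opseq_of T) = T"
proof -
  have "(\<lambda>i. if i \<in> I then opseq_of T i x else 0) = seq (T x)" for x
    using assms by (force simp: ell2_on_def opseq_of_apply)
  then show ?thesis by (simp add: analysis_op_def seq_inverse blinfun_apply_inverse)
qed

text \<open>
  \<open>T\<^sub>A\<^sup>*\<close>, taken on all of \<open>\<ell>\<^sup>2(\<nat>, K)\<close>: as \<open>T\<^sub>A\<close> maps into \<open>ell2_on I\<close>, this is the adjoint on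
  \<open>\<ell>\<^sup>2(I, K)\<close>, extended by zero to the orthogonal complement of \<open>ell2_on I\<close>.
\<close>

definition synthesis_op :: "('f::{comm_monoid_add, t2_space}, 'h::real_normed_vector) hilbert
    \<Rightarrow> ('f, 'k::real_normed_vector) hilbert \<Rightarrow> nat set \<Rightarrow> ('h, 'k) opseq \<Rightarrow> ('k ell2 \<Rightarrow>\<^sub>L 'h)" where
  "synthesis_op H K I A = adj H (ell2 K) (analysis_op I A)"

definition frame_op :: "('f::{comm_monoid_add, t2_space}, 'h::real_normed_vector) hilbert
    \<Rightarrow> ('f, 'k::real_normed_vector) hilbert \<Rightarrow> nat set \<Rightarrow> ('h, 'k) opseq \<Rightarrow> ('h \<Rightarrow>\<^sub>L 'h)" where
  "frame_op H K I A = synthesis_op H K I A o\<^sub>L analysis_op I A"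

definition op_frame_bounds :: "('f::comm_ring_1, 'h::real_normed_vector) hilbert
    \<Rightarrow> ('f, 'k::real_normed_vector) hilbert \<Rightarrow> nat set \<Rightarrow> ('h, 'k) opseq
    \<Rightarrow> real \<Rightarrow> real \<Rightarrow> bool" where
  "op_frame_bounds H K I A \<alpha> \<beta> \<longleftrightarrow> 0 < \<alpha> \<and> 0 < \<beta> \<and> (\<forall>i\<in>I. A i \<in> bops H K) \<and>
     closure (module.span (scl H) (\<Union>i\<in>I. range (adj H K (A i)))) = UNIV \<and>
     (\<forall>x. (\<lambda>i. (norm (A i x))\<^sup>2) summable_on I \<and>
          \<alpha> * (norm x)\<^sup>2 \<le> (\<Sum>\<^sub>\<infinity>i\<in>I. (norm (A i x))\<^sup>2) \<and>
          (\<Sum>\<^sub>\<infinity>i\<in>I. (norm (A i x))\<^sup>2) \<le> \<beta> * (norm x)\<^sup>2)"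

definition op_frame :: "('f::comm_ring_1, 'h::real_normed_vector) hilbert
    \<Rightarrow> ('f, 'k::real_normed_vector) hilbert \<Rightarrow> nat set \<Rightarrow> ('h, 'k) opseq \<Rightarrow> bool" where
  "op_frame H K I A \<longleftrightarrow> (\<exists>\<alpha> \<beta>. op_frame_bounds H K I A \<alpha> \<beta>)"

definition dual_of :: "('f, 'h::real_normed_vector) hilbert \<Rightarrow> ('f, 'k::real_normed_vector) hilbert
    \<Rightarrow> nat set \<Rightarrow> ('h, 'k) opseq \<Rightarrow> ('h, 'k) opseq \<Rightarrow> bool" where
  "dual_of H K I A C \<longleftrightarrow> bessel_seq H K I C \<and>
     (\<forall>x. ((\<lambda>i. adj H K (C i) (A i x)) has_sum x) I)"

text \<open>\<open>dual_params H K I A\<close> is \<open>\<L>\<^sub>A\<close>, and \<open>dual H K I A L\<close> is the sequence with analysis operator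
  \<open>T\<^sub>A S\<^sub>A\<^sup>-\<^sup>1 + L\<close>.\<close>

definition dual_params :: "('f::{comm_monoid_add, t2_space}, 'h::real_normed_vector) hilbert
    \<Rightarrow> ('f, 'k::real_normed_vector) hilbert \<Rightarrow> nat set \<Rightarrow> ('h, 'k) opseq \<Rightarrow> ('h \<Rightarrow>\<^sub>L 'k ell2) set" where
  "dual_params H K I A =
     {L \<in> bops H (ell2 K). range L \<subseteq> ell2_on I \<and> synthesis_op H K I A o\<^sub>L L = 0}"

definition dual :: "('f::{comm_monoid_add, t2_space}, 'h::real_normed_vector) hilbert
    \<Rightarrow> ('f, 'k::real_normed_vector) hilbert \<Rightarrow> nat set \<Rightarrow> ('h, 'k) opseq \<Rightarrow> ('h \<Rightarrow>\<^sub>L 'k ell2)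
    \<Rightarrow> ('h, 'k) opseq" where
  "dual H K I A L = opseq_of ((analysis_op I A o\<^sub>L blinfun_inv (frame_op H K I A)) + L)"

definition synthesis_ker :: "('f::{comm_monoid_add, t2_space}, 'h::real_normed_vector) hilbert
    \<Rightarrow> ('f, 'k::real_normed_vector) hilbert \<Rightarrow> nat set \<Rightarrow> ('h, 'k) opseq \<Rightarrow> 'k ell2 set" where
  "synthesis_ker H K I A = {f \<in> ell2_on I. synthesis_op H K I A f = 0}"

definition perturbation :: "('f, 'h::real_normed_vector) hilbert \<Rightarrow> ('f, 'k::real_normed_vector) hilbert
    \<Rightarrow> nat set \<Rightarrow> real \<Rightarrow> ('h, 'k) opseq \<Rightarrow> ('h, 'k) opseq \<Rightarrow> bool" where
  "perturbation H K I \<mu> A B \<longleftrightarrow> 0 < \<mu> \<and> bessel_seq H K I A \<and> bessel_seq H K I B \<and>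
     norm (analysis_op I A - analysis_op I B) \<le> \<mu>"

end

theory Submission
  imports Defs
begin

text \<open>
  Write \<open>T = T\<^sub>B\<close>, \<open>S = T\<^sup>* T\<close> and \<open>U = T\<^sub>A S\<^sub>A\<^sup>-\<^sup>1 + L\<close>. The perturbation bound gives
  \<open>(\<surd>\<alpha> - \<mu>) \<parallel>x\<parallel> \<le> \<parallel>T x\<parallel>\<close>, so \<open>S\<close> is coercive, hence invertible, and \<open>Q = T S\<^sup>-\<^sup>1 T\<^sup>*\<close> is the
  orthogonal projection onto the range of \<open>T\<close>; on \<open>\<ell>\<^sup>2(I, K)\<close> the projection onto \<open>ker T\<^sup>*\<close> is
  \<open>1 - Q\<close>. The dual \<open>D\<close> of \<open>B\<close> with parameter \<open>(1 - Q) U\<close> therefore satisfies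
  \<open>T\<^sub>D - U = T S\<^sup>-\<^sup>1 (1 - T\<^sup>* U)\<close>. As \<open>T\<^sup>* T\<^sub>C = 1\<close> for each dual \<open>C\<close> of \<open>B\<close>, this equals
  \<open>Q (T\<^sub>C - U)\<close>, which proves optimality; as \<open>T\<^sub>A\<^sup>* U = 1\<close>, it also equals
  \<open>T S\<^sup>-\<^sup>1 (T\<^sub>A\<^sup>* - T\<^sup>*) U\<close>, where \<open>\<parallel>T S\<^sup>-\<^sup>1\<parallel> \<le> 1 / (\<surd>\<alpha> - \<mu>)\<close> and \<open>\<parallel>U\<parallel> \<le> 1 / \<surd>\<alpha> + \<parallel>L\<parallel>\<close>.
\<close>

section \<open>Real parts of scalars\<close>

lemma conjugate_0 [simp]: "conjugate (0 :: 'f::rc_field) = 0"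
  using conjugate_add[of "0::'f" 0] by simp

lemma conjugate_of_real [simp]: "conjugate (of_real r :: 'f::rc_field) = of_real r"
proof (cases "r = 0")
  case False
  have "of_real r * conjugate (of_real r :: 'f) = of_real r * of_real r"
    using mult_conjugate[of "of_real r :: 'f"]
    by (simp add: scaleR_conv_of_real power2_eq_square flip: of_real_mult)
  then show ?thesis using False by simp
qed simp

text \<open>Involutivity is not an axiom. The product \<open>x * conjugate x\<close> is real, hence
  fixed by conjugation; conjugating it and cancelling \<open>conjugate x\<close> gives the
  claim.\<close>

lemma conjugate_conjugate [simp]: "conjugate (conjugate (x :: 'f::rc_field)) = x"
proof (cases "x = 0")
  case False
  have "x * conjugate x = of_real ((norm x)\<^sup>2)"
    by (simp only: mult_conjugate scaleR_conv_of_real mult_1_right)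
  moreover from this have "conjugate x * conjugate (conjugate x) = of_real ((norm x)\<^sup>2)"
    by (metis conjugate_mult conjugate_of_real)
  moreover from calculation False have "conjugate x \<noteq> 0"
    by force
  ultimately show ?thesis
    by (metis mult.commute mult_left_cancel)
qed simp

lemma norm_conjugate [simp]: "norm (conjugate (x :: 'f::rc_field)) = norm x"
proof (cases "x = 0")
  case False
  have "norm x * norm (conjugate x) = norm x * norm x"
    using arg_cong[OF mult_conjugate[of x], of norm] by (simp add: norm_mult power2_eq_square)
  then show ?thesis using False by simp
qed simp

text \<open>The real part, obtained by expanding \<open>(x + 1) * conjugate (x + 1)\<close>.\<close>

definition rc_re :: "'f::rc_field \<Rightarrow> real" where
  "rc_re x = ((norm (x + 1))\<^sup>2 - (norm x)\<^sup>2 - 1) / 2"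

lemma add_conjugate: "x + conjugate x = of_real (2 * rc_re (x :: 'f::rc_field))"
proof -
  have 1: "conjugate (1::'f) = 1" using conjugate_of_real[of 1] by simp
  have sq: "y * conjugate y = of_real ((norm y)\<^sup>2)" for y :: 'f
    by (simp only: mult_conjugate scaleR_conv_of_real mult_1_right)
  have "x + conjugate x = (x + 1) * conjugate (x + 1) - x * conjugate x - 1"
    by (simp add: conjugate_add 1 algebra_simps)
  also have "\<dots> = of_real ((norm (x + 1))\<^sup>2 - (norm x)\<^sup>2 - 1)"
    by (simp only: sq of_real_diff of_real_1)
  finally show ?thesis by (simp add: rc_re_def)
qed

lemma rc_re_eqI:
  assumes "x + conjugate x = of_real (2 * r)"
  shows "rc_re (x :: 'f::rc_field) = r"
proof -
  have "(of_real (2 * rc_re x) :: 'f) = of_real (2 * r)"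
    using assms by (simp only: add_conjugate)
  then show ?thesis by (simp only: of_real_eq_iff)
qed

lemma rc_re_add: "rc_re (x + y) = rc_re x + rc_re (y :: 'f::rc_field)"
  using add_conjugate[of x] add_conjugate[of y]
  by (intro rc_re_eqI) (simp add: conjugate_add algebra_simps)

lemma rc_re_of_real [simp]: "rc_re (of_real r :: 'f::rc_field) = r"
  by (rule rc_re_eqI) simp

lemma rc_re_of_real_mult: "rc_re (of_real r * x) = r * rc_re (x :: 'f::rc_field)"
  using add_conjugate[of x]
  by (intro rc_re_eqI) (simp add: conjugate_mult mult.left_commute flip: distrib_left)

lemma rc_re_conjugate [simp]: "rc_re (conjugate x) = rc_re (x :: 'f::rc_field)"
  using add_conjugate[of x] by (intro rc_re_eqI) (simp add: add.commute)

lemma rc_re_minus [simp]: "rc_re (- x) = - rc_re (x :: 'f::rc_field)"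
  using rc_re_of_real_mult[of "-1" x] by simp

lemma abs_rc_re_le: "\<bar>rc_re x\<bar> \<le> norm (x :: 'f::rc_field)"
proof -
  have "norm (x + conjugate x) \<le> norm x + norm x"
    using norm_triangle_ineq[of x "conjugate x"] by simp
  then show ?thesis by (simp add: add_conjugate)
qed

text \<open>Choosing \<open>c = conjugate (a - b)\<close> turns the difference of the two sides into
  the square of \<open>norm (a - b)\<close>. This lifts identities between real parts to identities
  between scalars.\<close>

lemma rc_eqI:
  assumes "\<And>c. rc_re (c * a) = rc_re (c * b)"
  shows "a = (b :: 'f::rc_field)"
proof -
  have "rc_re (conjugate (a - b) * (a - b)) = 0"
    using assms[of "conjugate (a - b)"] rc_re_add[of "conjugate (a - b) * a" "- (conjugate (a - b) * b)"]
    by (simp add: right_diff_distrib)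
  moreover have "conjugate (a - b) * (a - b) = of_real ((norm (a - b))\<^sup>2)"
    by (simp only: mult_conjugate scaleR_conv_of_real mult_1_right mult.commute[of "conjugate _"])
  ultimately have "(norm (a - b))\<^sup>2 = 0" by (simp only: rc_re_of_real)
  then show ?thesis by simp
qed

section \<open>Inner product spaces\<close>

text \<open>The axioms of \<open>hilbert_space\<close> without completeness: they hold for \<open>ell2 K\<close>, whose completeness
  is never needed, because the only projection in \<open>\<ell>\<^sup>2\<close> that occurs has an explicit formula.\<close>

locale pre_hilbert = vector_space "scl H"
  for H :: "('f::rc_field, 'a::real_normed_vector) hilbert" +
  assumes scl_of_real: "scl H (of_real r) x = r *\<^sub>R x"
    and ip_add: "ip H (x + y) z = ip H x z + ip H y z"
    and ip_scl: "ip H (scl H c x) y = c * ip H x y"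
    and ip_conjugate: "ip H y x = conjugate (ip H x y)"
    and ip_self: "ip H x x = of_real ((norm x)\<^sup>2)"
begin

text \<open>The minimisation and contraction arguments below need only this real inner product, so
  they treat both scalar fields at once.\<close>

definition rip :: "'a \<Rightarrow> 'a \<Rightarrow> real" where
  "rip x y = rc_re (ip H x y)"

lemma ip_add_right: "ip H x (y + z) = ip H x y + ip H x z"
  by (metis conjugate_add ip_add ip_conjugate)

lemma ip_scl_right: "ip H x (scl H c y) = conjugate c * ip H x y"
  by (metis conjugate_mult ip_scl ip_conjugate)

lemma ip_scaleR: "ip H (r *\<^sub>R x) y = of_real r * ip H x y"
  using ip_scl[of "of_real r" x y] by (simp add: scl_of_real)

lemma ip_scaleR_right: "ip H x (r *\<^sub>R y) = of_real r * ip H x y"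
  using ip_scl_right[of x "of_real r" y] by (simp add: scl_of_real)

lemma ip_minus: "ip H (x - y) z = ip H x z - ip H y z"
  using ip_add[of x "(-1) *\<^sub>R y" z] by (simp add: ip_scaleR[of "-1", simplified])

lemma ip_minus_right: "ip H x (y - z) = ip H x y - ip H x z"
  using ip_add_right[of x y "(-1) *\<^sub>R z"] by (simp add: ip_scaleR_right[of _ "-1", simplified])

lemma ip_zero [simp]: "ip H 0 x = 0" "ip H x 0 = 0"
  using ip_scaleR[of 0 0 x] ip_scaleR_right[of x 0 0] by simp_all

lemma norm_add_sq: "(norm (x + y))\<^sup>2 = (norm x)\<^sup>2 + (norm y)\<^sup>2 + 2 * rip x y"
proof -
  have "(of_real ((norm (x + y))\<^sup>2) :: 'f)
      = ip H x x + ip H y y + (ip H x y + conjugate (ip H x y))"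
    by (simp only: ip_self[symmetric] ip_add ip_add_right ip_conjugate[of y x]) (simp add: ac_simps)
  also have "\<dots> = of_real ((norm x)\<^sup>2 + (norm y)\<^sup>2 + 2 * rip x y)"
    by (simp only: ip_self add_conjugate rip_def of_real_add)
  finally show ?thesis by (simp only: of_real_eq_iff)
qed

lemma rip_scaleR: "rip (r *\<^sub>R x) y = r * rip x y" "rip x (r *\<^sub>R y) = r * rip x y"
  by (simp_all add: rip_def ip_scaleR ip_scaleR_right rc_re_of_real_mult)

lemma rip_commute: "rip x y = rip y x"
  by (simp add: rip_def ip_conjugate[of x y])

lemma parallelogram:
  fixes x y :: 'a
  shows "(norm (x - y))\<^sup>2 = 2 * (norm x)\<^sup>2 + 2 * (norm y)\<^sup>2 - (norm (x + y))\<^sup>2"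
  using norm_add_sq[of x y] norm_add_sq[of x "- y"] rip_scaleR(2)[of x "-1" y] by simp

text \<open>Cauchy-Schwarz: for unit vectors, expanding the squared norm of
  \<open>x + s *\<^sub>R y\<close> with \<open>s = 1\<close> and \<open>s = -1\<close> bounds
  \<open>rip x y\<close> from both sides; the general case follows by scaling.\<close>

lemma abs_rip_le: "\<bar>rip x y\<bar> \<le> norm x * norm y"
proof (cases "x = 0 \<or> y = 0")
  case True
  have "rc_re (0::'f) = 0" using rc_re_of_real[of 0] by simp
  with True show ?thesis by (auto simp: rip_def)
next
  case False
  have "0 \<le> 2 + 2 * s * rip (x /\<^sub>R norm x) (y /\<^sub>R norm y)" if s: "\<bar>s\<bar> = 1" for s
  proof -
    let ?x = "x /\<^sub>R norm x" and ?y = "y /\<^sub>R norm y"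
    have "norm ?x = 1" "norm (s *\<^sub>R ?y) = 1" using False s by (simp_all add: abs_mult)
    then have "(norm (?x + s *\<^sub>R ?y))\<^sup>2 = 2 + 2 * s * rip ?x ?y"
      by (simp add: norm_add_sq rip_scaleR(2)[of ?x s] del: scaleR_scaleR)
    then show ?thesis by (metis zero_le_power2)
  qed
  from this[of 1] this[of "-1"] have "\<bar>rip (x /\<^sub>R norm x) (y /\<^sub>R norm y)\<bar> \<le> 1"
    by simp
  then show ?thesis using False by (simp add: rip_scaleR abs_mult field_simps)
qed

lemma norm_scl: "norm (scl H c x) = norm c * norm x"
proof -
  have "(of_real ((norm (scl H c x))\<^sup>2) :: 'f) = (c * conjugate c) * ip H x x"
    by (simp only: ip_self[symmetric] ip_scl ip_scl_right) (simp add: ac_simps)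
  also have "\<dots> = of_real ((norm c * norm x)\<^sup>2)"
    by (simp only: mult_conjugate ip_self scaleR_conv_of_real mult_1_right power_mult_distrib of_real_mult)
  finally show ?thesis by (simp only: of_real_eq_iff) (simp add: power2_eq_iff_nonneg)
qed

text \<open>Scaling \<open>x\<close> by the conjugate of \<open>ip H x y\<close> makes the inner
  product real and nonnegative, so the bound for \<open>rip\<close> applies to it.\<close>

lemma norm_ip_le: "norm (ip H x y) \<le> norm x * norm y"
proof (cases "ip H x y = 0")
  case False
  let ?c = "conjugate (ip H x y)"
  have "ip H (scl H ?c x) y = of_real ((norm (ip H x y))\<^sup>2)"
    by (simp only: ip_scl mult_conjugate scaleR_conv_of_real mult_1_right mult.commute[of "conjugate _"])
  then have "(norm (ip H x y))\<^sup>2 = rip (scl H ?c x) y"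
    by (simp only: rip_def rc_re_of_real)
  also have "\<dots> \<le> norm (ip H x y) * (norm x * norm y)"
    using abs_rip_le[of "scl H ?c x" y] by (simp add: norm_scl mult.assoc)
  finally show ?thesis using False by (simp add: power2_eq_square)
qed simp

lemma bounded_linear_ip: "bounded_linear (\<lambda>x. ip H x y)"
  by (rule bounded_linear_intro[where K = "norm y"])
    (simp_all add: ip_add ip_scaleR norm_ip_le scaleR_conv_of_real)

lemma eq_if_ip_eq:
  assumes "\<And>x. ip H x y = ip H x z"
  shows "y = z"
proof -
  have "ip H (y - z) (y - z) = 0" by (simp add: ip_minus_right assms)
  then show ?thesis by (simp add: ip_self)
qed

end

sublocale hilbert_space \<subseteq> pre_hilbert
  by unfold_locales (fact scl_of_real ip_add ip_scl ip_conjugate ip_self)+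

section \<open>Consequences of completeness: Riesz representation and coercive operators\<close>

context hilbert_space
begin

text \<open>Riesz: the representing vector minimises \<open>\<parallel>x\<parallel>\<^sup>2 - 2 g x\<close>.\<close>

lemma real_riesz:
  fixes g :: "'a \<Rightarrow> real"
  assumes g: "bounded_linear g"
  shows "\<exists>z. \<forall>x. g x = rip x z"
proof -
  interpret g: bounded_linear g by fact
  define J where "J x = (norm x)\<^sup>2 - 2 * g x" for x
  define m where "m = (INF x. J x)"
  have lower: "- (onorm g)\<^sup>2 \<le> J x" for x
  proof -
    have "g x \<le> onorm g * norm x" using onorm[OF g, of x] by simp
    moreover have "0 \<le> (norm x - onorm g)\<^sup>2" by simp
    ultimately show ?thesis by (simp add: J_def power2_eq_square algebra_simps)
  qed
  then have bdd: "bdd_below (range J)" by (intro bdd_belowI) auto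
  have m: "m \<le> J x" for x unfolding m_def by (rule cINF_lower[OF bdd]) simp
  have dist_le: "(norm (x - y))\<^sup>2 \<le> 2 * (J x - m) + 2 * (J y - m)" for x y
  proof -
    \<comment> \<open>Since \<open>J\<close> is at least \<open>m\<close> at the midpoint, the
      parallelogram law forces near-minimisers to be close to each other; minimising sequences are
      therefore Cauchy.\<close>
    have "J ((1/2) *\<^sub>R (x + y)) = (norm (x + y))\<^sup>2 / 4 - g x - g y"
      by (simp add: J_def g.scaleR[of "1/2" "x + y"] g.add power_divide add_divide_distrib del: scaleR_right_distrib)
    then show ?thesis
      using parallelogram[of x y] m[of "(1/2) *\<^sub>R (x + y)"] by (simp add: J_def)
  qed
  have "\<exists>x. J x < m + 1 / real (Suc n)" for n
  proof (rule ccontr)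
    assume "\<nexists>x. J x < m + 1 / real (Suc n)"
    then have "m + 1 / real (Suc n) \<le> (INF x. J x)" by (intro cINF_greatest) (auto simp: not_less)
    then show False by (simp add: m_def[symmetric])
  qed
  then obtain X where X: "\<And>n. J (X n) < m + 1 / real (Suc n)" by metis
  have "Cauchy X"
  proof (rule metric_CauchyI)
    fix e :: real assume e: "0 < e"
    then obtain N where N: "4 / e\<^sup>2 < real N" using reals_Archimedean2 by blast
    moreover have "0 < 4 / e\<^sup>2" using e by simp
    ultimately have N0: "0 < real N" by linarith
    have "dist (X k) (X n) < e" if "k \<ge> N" "n \<ge> N" for k n
    proof -
      have *: "J (X j) - m < 1 / real N" if "j \<ge> N" for j
      proof -
        have "1 / real (Suc j) \<le> 1 / real N" using that N0 by (simp add: field_simps)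
        then show ?thesis using X[of j] by linarith
      qed
      have "(norm (X k - X n))\<^sup>2 < 4 / real N"
        using dist_le[of "X k" "X n"] *[OF that(1)] *[OF that(2)] by simp
      also have "\<dots> \<le> e\<^sup>2" using N N0 e by (simp add: field_simps)
      finally show ?thesis using e by (simp add: dist_norm power_less_imp_less_base)
    qed
    then show "\<exists>M. \<forall>k\<ge>M. \<forall>n\<ge>M. dist (X k) (X n) < e" by blast
  qed
  then obtain z where z: "X \<longlonglongrightarrow> z" using Cauchy_convergent convergent_def by blast
  have "(\<lambda>n. J (X n)) \<longlonglongrightarrow> J z"
    unfolding J_def by (intro tendsto_intros z g.tendsto)
  moreover have "(\<lambda>n. m + 1 / real (Suc n)) \<longlonglongrightarrow> m + 0"
    by (intro tendsto_add tendsto_const LIMSEQ_Suc lim_1_over_n)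
  ultimately have Jz: "J z \<le> m"
    using X by (intro LIMSEQ_le[of "\<lambda>n. J (X n)" _ "\<lambda>n. m + 1 / real (Suc n)"]) (auto intro: less_imp_le)
  have "g x = rip x z" for x
  proof -
    define d where "d = rip z x - g x"
    \<comment> \<open>Minimality of \<open>z\<close> along the line
      \<open>z + t *\<^sub>R x\<close>; a quadratic in \<open>t\<close> without constant term stays
      nonnegative only if its linear coefficient vanishes.\<close>
    have pos: "0 \<le> t\<^sup>2 * (norm x)\<^sup>2 + 2 * t * d" for t
      using m[of "z + t *\<^sub>R x"] Jz norm_add_sq[of z "t *\<^sub>R x"]
      by (simp add: J_def d_def rip_scaleR g.add g.scaleR power_mult_distrib algebra_simps)
    \<comment> \<open>Adding 1 keeps the divisor positive even for \<open>x = 0\<close>;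
      \<open>u\<close> is the minimiser of \<open>u\<^sup>2 * w + 2 * u * d\<close>, with value
      \<open>- (d\<^sup>2 / w)\<close>.\<close>
    define w where "w = (norm x)\<^sup>2 + 1"
    have w: "0 < w" by (simp add: w_def add_nonneg_pos)
    define u where "u = - d / w"
    have "0 \<le> u\<^sup>2 * w + 2 * u * d"
      using add_nonneg_nonneg[OF pos[of u] zero_le_power2[of u]] by (simp add: w_def algebra_simps)
    also have "\<dots> = - (d\<^sup>2 / w)"
      using w by (simp add: u_def field_simps power2_eq_square)
    finally have "d\<^sup>2 \<le> 0" using w by (simp add: divide_le_0_iff)
    then show ?thesis by (simp add: d_def rip_commute)
  qed
  then show ?thesis by blast
qed

text \<open>The real version represents the real part of \<open>f\<close>; applying it to all scalar
  multiples of \<open>x\<close> recovers \<open>f x\<close> through \<open>rc_eqI\<close>.\<close>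

lemma riesz:
  assumes f: "bounded_linear f" and scl: "\<And>c x. f (scl H c x) = c * f x"
  shows "\<exists>z. \<forall>x. f x = ip H x z"
proof -
  have "bounded_linear (\<lambda>x. rc_re (f x))"
  proof -
    interpret f: bounded_linear f by fact
    obtain k where k: "\<And>x. norm (f x) \<le> norm x * k" using f.bounded by blast
    show ?thesis
      by (rule bounded_linear_intro[where K = k])
        (auto simp: f.add f.scaleR rc_re_add scaleR_conv_of_real rc_re_of_real_mult
          intro: order_trans[OF abs_rc_re_le k])
  qed
  then obtain z where z: "\<And>x. rc_re (f x) = rip x z" using real_riesz by blast
  have "f x = ip H x z" for x
  proof (rule rc_eqI)
    fix c show "rc_re (c * f x) = rc_re (c * ip H x z)"
      using z[of "scl H c x"] by (simp add: rip_def scl ip_scl)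
  qed
  then show ?thesis by blast
qed

text \<open>For small \<open>t > 0\<close> the map \<open>x \<mapsto> x - t (S x - y)\<close> is a contraction.\<close>

lemma coercive_surj:
  fixes S :: "'a \<Rightarrow>\<^sub>L 'a"
  assumes a: "0 < a" and co: "\<And>x. a * (norm x)\<^sup>2 \<le> rip (S x) x"
  shows "surj S"
proof -
  \<comment> \<open>The summand \<open>a\<close> ensures \<open>0 < b\<close> and
    \<open>a \<le> b\<close>. The step size \<open>t\<close> minimises
    \<open>1 - 2 * t * a + t\<^sup>2 * b\<^sup>2\<close>, which bounds the squared contraction
    factor, and \<open>q\<^sup>2\<close> is the minimum.\<close>
  define b where "b = norm S + a"
  define t where "t = a / b\<^sup>2"
  define q where "q = sqrt (1 - (a / b)\<^sup>2)"
  have b: "0 < b" "a \<le> b" using a by (simp_all add: b_def add_nonneg_pos)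
  have ab: "0 < (a / b)\<^sup>2" "(a / b)\<^sup>2 \<le> 1" using a b by (auto simp: power_le_one)
  then have q: "0 \<le> q" "q < 1" by (auto simp: q_def)
  have contr: "norm (x - t *\<^sub>R S x) \<le> q * norm x" for x
  proof -
    have "norm (S x) \<le> b * norm x"
      using norm_blinfun[of S x] a mult_right_mono[of "norm S" b "norm x"] by (simp add: b_def)
    then have Sx: "(norm (S x))\<^sup>2 \<le> b\<^sup>2 * (norm x)\<^sup>2"
      using power_mono[of "norm (S x)" "b * norm x" 2] by (simp add: power_mult_distrib)
    have t: "0 < t" using a b by (simp add: t_def)
    have "(norm (x - t *\<^sub>R S x))\<^sup>2 = (norm x)\<^sup>2 + t\<^sup>2 * (norm (S x))\<^sup>2 - 2 * t * rip (S x) x"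
      using norm_add_sq[of x "(- t) *\<^sub>R S x"]
      by (simp only: rip_scaleR rip_commute[of x]) (simp add: power_mult_distrib)
    also have "\<dots> \<le> (norm x)\<^sup>2 + t\<^sup>2 * (b\<^sup>2 * (norm x)\<^sup>2) - 2 * t * (a * (norm x)\<^sup>2)"
    proof -
      have "t\<^sup>2 * (norm (S x))\<^sup>2 \<le> t\<^sup>2 * (b\<^sup>2 * (norm x)\<^sup>2)"
        using Sx by (intro mult_left_mono) auto
      moreover have "2 * t * (a * (norm x)\<^sup>2) \<le> 2 * t * rip (S x) x"
        using t co[of x] by (intro mult_left_mono) auto
      ultimately show ?thesis by linarith
    qed
    also have "\<dots> = (1 - (a / b)\<^sup>2) * (norm x)\<^sup>2"
    proof -
      have "t\<^sup>2 * b\<^sup>2 = (a / b)\<^sup>2" "t * a = (a / b)\<^sup>2"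
        using b by (simp_all add: t_def power2_eq_square)
      then have "t\<^sup>2 * (b\<^sup>2 * (norm x)\<^sup>2) = (a / b)\<^sup>2 * (norm x)\<^sup>2"
        "2 * t * (a * (norm x)\<^sup>2) = 2 * ((a / b)\<^sup>2 * (norm x)\<^sup>2)"
        by (simp_all only: mult.assoc[symmetric]) (simp_all add: mult.assoc)
      then show ?thesis unfolding left_diff_distrib by linarith
    qed
    also have "\<dots> = (q * norm x)\<^sup>2" using ab by (simp add: q_def power_mult_distrib)
    finally show ?thesis by (rule power2_le_imp_le) (use q in simp)
  qed
  have "\<exists>x. S x = y" for y
  proof -
    have "\<exists>!x. x - t *\<^sub>R (S x - y) = x"
    proof (rule banach_fix_type[OF q], intro allI)
      fix x x'
      show "dist (x - t *\<^sub>R (S x - y)) (x' - t *\<^sub>R (S x' - y)) \<le> q * dist x x'"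
      proof -
        have "(x - t *\<^sub>R (S x - y)) - (x' - t *\<^sub>R (S x' - y)) = (x - x') - t *\<^sub>R S (x - x')"
          by (simp add: blinfun.diff_right scaleR_right_diff_distrib)
        then show ?thesis using contr[of "x - x'"] by (simp only: dist_norm)
      qed
    qed
    then obtain x where "x - t *\<^sub>R (S x - y) = x" by blast
    then have "t *\<^sub>R (S x - y) = 0" by simp
    then show ?thesis using a b by (intro exI[of _ x]) (simp add: t_def)
  qed
  then show ?thesis unfolding surj_def by metis
qed

end

section \<open>Adjoints and operators bounded below\<close>

text \<open>Adjoints come from Riesz in \<open>X\<close>, where completeness is assumed;
  \<open>Y\<close> is a pre-Hilbert space so that \<open>ell2 K\<close> can take its place.\<close>

locale hilbert_pair = X: hilbert_space X + Y: pre_hilbert Y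
  for X :: "('f::rc_field, 'a::banach) hilbert" and Y :: "('f, 'b::real_normed_vector) hilbert"
begin

lemma ex1_adj:
  assumes T: "T \<in> bops X Y"
  shows "\<exists>!z. \<forall>x. ip Y (T x) y = ip X x z"
proof (rule ex_ex1I)
  show "\<exists>z. \<forall>x. ip Y (T x) y = ip X x z"
  proof (rule X.riesz)
    show "bounded_linear (\<lambda>x. ip Y (T x) y)"
      using bounded_linear_compose[OF Y.bounded_linear_ip[of y] blinfun.bounded_linear_right[of T]] .
  qed (use T in \<open>simp add: bops_def Y.ip_scl\<close>)
  show "z = z'" if "\<forall>x. ip Y (T x) y = ip X x z" "\<forall>x. ip Y (T x) y = ip X x z'" for z z'
    using that by (intro X.eq_if_ip_eq) simp
qed

text \<open>\<open>adj\<close> is a \<open>Blinfun\<close> of a pointwise description, so its values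
  are known only after that map is shown bounded linear. The bound comes from testing the adjoint
  identity at \<open>h y\<close> itself.\<close>

lemma adj_properties:
  assumes T: "T \<in> bops X Y"
  shows ip_adj: "ip Y (T x) y = ip X x (adj X Y T y)"
    and norm_adj_le: "norm (adj X Y T y) \<le> norm T * norm y"
    and adj_in_bops: "adj X Y T \<in> bops Y X"
proof -
  define h where "h = (\<lambda>y. THE z. \<forall>x. ip Y (T x) y = ip X x z)"
  have h: "ip Y (T x) y = ip X x (h y)" for x y
    unfolding h_def by (rule theI'[OF ex1_adj[OF T], THEN spec])
  have h_le: "norm (h y) \<le> norm T * norm y" for y
  proof (cases "h y = 0")
    case False
    have "(norm (h y))\<^sup>2 = norm (ip Y (T (h y)) y)" by (simp add: h X.ip_self del: of_real_power)
    also have "\<dots> \<le> norm (T (h y)) * norm y" by (rule Y.norm_ip_le)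
    also have "\<dots> \<le> (norm T * norm (h y)) * norm y"
      by (intro mult_right_mono norm_blinfun) simp
    finally have "norm (h y) * norm (h y) \<le> norm (h y) * (norm T * norm y)"
      by (simp add: power2_eq_square ac_simps)
    then show ?thesis using False by (simp add: mult_le_cancel_left)
  qed simp
  have "bounded_linear h"
  proof (rule bounded_linear_intro[where K = "norm T"])
    show "h (y + z) = h y + h z" for y z
      by (rule X.eq_if_ip_eq) (simp add: h[symmetric] Y.ip_add_right X.ip_add_right)
    show "h (r *\<^sub>R y) = r *\<^sub>R h y" for r y
      by (rule X.eq_if_ip_eq) (simp add: h[symmetric] Y.ip_scaleR_right X.ip_scaleR_right)
    show "norm (h y) \<le> norm y * norm T" for y using h_le[of y] by (simp add: mult.commute)
  qed
  then have adj: "blinfun_apply (adj X Y T) = h"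
    by (simp add: adj_def h_def[symmetric] bounded_linear_Blinfun_apply)
  show "ip Y (T x) y = ip X x (adj X Y T y)" and "norm (adj X Y T y) \<le> norm T * norm y"
    by (simp_all add: adj h h_le)
  have "h (scl Y c y) = scl X c (h y)" for c y
    by (rule X.eq_if_ip_eq) (simp add: h[symmetric] Y.ip_scl_right X.ip_scl_right)
  then show "adj X Y T \<in> bops Y X" by (simp add: bops_def adj)
qed

lemma ip_adj_left:
  assumes T: "T \<in> bops X Y"
  shows "ip X (adj X Y T y) x = ip Y y (T x)"
  by (simp only: X.ip_conjugate[of _ x] Y.ip_conjugate[of _ "T x"] ip_adj[OF T])

lemma bops_diff:
  assumes "T \<in> bops X Y" "U \<in> bops X Y"
  shows "T - U \<in> bops X Y"
  using assms by (simp add: bops_def blinfun.diff_left Y.scale_right_diff_distrib)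

lemma bops_add:
  assumes "T \<in> bops X Y" "U \<in> bops X Y"
  shows "T + U \<in> bops X Y"
  using assms by (simp add: bops_def blinfun.add_left Y.scale_right_distrib)

lemma adj_diff:
  assumes T: "T \<in> bops X Y" and U: "U \<in> bops X Y"
  shows "adj X Y (T - U) y = adj X Y T y - adj X Y U y"
proof (rule X.eq_if_ip_eq)
  fix x
  show "ip X x (adj X Y (T - U) y) = ip X x (adj X Y T y - adj X Y U y)"
    by (simp add: X.ip_minus_right blinfun.diff_left Y.ip_minus
        ip_adj[OF T, symmetric] ip_adj[OF U, symmetric] ip_adj[OF bops_diff[OF T U], symmetric])
qed

text \<open>Taking adjoints of \<open>T* U = 1\<close> gives \<open>U* T = 1\<close>; this exchanges
  the roles of a frame and its dual.\<close>

lemma adj_compose_eq_id_commute: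
  assumes T: "T \<in> bops X Y" and U: "U \<in> bops X Y" and id: "\<And>x. adj X Y T (U x) = x"
  shows "adj X Y U (T x) = x"
proof (rule X.eq_if_ip_eq)
  fix z
  have "ip X z (adj X Y U (T x)) = ip Y (U z) (T x)" by (simp add: ip_adj[OF U])
  also have "\<dots> = ip X z x" by (simp add: id flip: ip_adj_left[OF T])
  finally show "ip X z (adj X Y U (T x)) = ip X z x" .
qed

end

section \<open>Operators bounded below, the inverse of \<open>T* T\<close> and the projection onto
  the range\<close>

locale bounded_below = hilbert_pair +
  fixes T :: "'b \<Rightarrow>\<^sub>L 'c" and c :: real
  assumes T: "T \<in> bops X Y" and c_pos: "0 < c" and below: "c * norm x \<le> norm (T x)"
begin

definition S :: "'b \<Rightarrow>\<^sub>L 'b" where "S = adj X Y T o\<^sub>L T"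

abbreviation "R \<equiv> blinfun_inv S"

lemma S_apply: "S x = adj X Y T (T x)"
  by (simp add: S_def)

lemma rip_S: "X.rip (S x) x = (norm (T x))\<^sup>2"
  by (simp only: X.rip_def S_apply ip_adj_left[OF T] Y.ip_self rc_re_of_real)

lemma S_coercive: "c\<^sup>2 * (norm x)\<^sup>2 \<le> X.rip (S x) x"
  using power_mono[OF below[of x], of 2] c_pos by (simp add: rip_S power_mult_distrib)

lemma norm_S_ge: "c\<^sup>2 * norm x \<le> norm (S x)"
proof (cases "x = 0")
  case False
  have "c\<^sup>2 * (norm x)\<^sup>2 \<le> norm (S x) * norm x"
    using S_coercive[of x] X.abs_rip_le[of "S x" x] by linarith
  then have "(c\<^sup>2 * norm x) * norm x \<le> norm (S x) * norm x"
    by (simp add: power2_eq_square[of "norm x"])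
  then show ?thesis using False by (simp add: mult_le_cancel_right)
qed simp

lemma bij_S: "bij S"
proof (rule bijI)
  show "inj S"
  proof (rule injI)
    fix x y assume "S x = S y"
    then have "c\<^sup>2 * norm (x - y) \<le> 0" using norm_S_ge[of "x - y"] by (simp add: blinfun.diff_right)
    then show "x = y" using c_pos by (simp add: mult_le_0_iff)
  qed
  show "surj S" using c_pos S_coercive by (intro X.coercive_surj[of "c\<^sup>2"]) auto
qed

text \<open>\<open>Blinfun\<close> returns the set-theoretic inverse only once it is known to be
  bounded, which \<open>norm_S_ge\<close> provides.\<close>

lemma R_apply: "blinfun_apply R = inv S"
proof -
  have Si: "S (inv S x) = x" for x using bij_S by (simp add: bij_is_surj surj_f_inv_f)
  have iS: "inv S (S x) = x" for x using bij_S by (simp add: bij_is_inj)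
  have "bounded_linear (inv S)"
  proof (rule bounded_linear_intro[where K = "1 / c\<^sup>2"])
    show "inv S (x + y) = inv S x + inv S y" for x y
      by (metis Si iS blinfun.add_right)
    show "inv S (r *\<^sub>R x) = r *\<^sub>R inv S x" for r x
      by (metis Si iS blinfun.scaleR_right)
    show "norm (inv S x) \<le> norm x * (1 / c\<^sup>2)" for x
      using norm_S_ge[of "inv S x"] c_pos by (simp add: Si field_simps)
  qed
  then show ?thesis by (simp add: blinfun_inv_def bounded_linear_Blinfun_apply)
qed

lemma S_R: "S (R x) = x"
  using bij_S by (simp add: R_apply bij_is_surj surj_f_inv_f)

lemma R_S: "R (S x) = x"
  using bij_S by (simp add: R_apply bij_is_inj)

lemma adj_T_R: "adj X Y T (T (R x)) = x"
  using S_R by (simp add: S_apply)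

lemma R_scl: "R (scl X k x) = scl X k (R x)"
proof -
  have "S (scl X k (R x)) = scl X k x"
    using T adj_in_bops[OF T] by (simp add: S_apply bops_def adj_T_R)
  then show ?thesis by (metis R_S)
qed

lemma T_R_in_bops: "T o\<^sub>L R \<in> bops X Y"
  using T by (simp add: bops_def R_scl)

text \<open>The squared norm of \<open>T (R x)\<close> equals \<open>rip x (R x)\<close>, and
  \<open>R x\<close> is controlled by \<open>T (R x)\<close> through the lower bound. Estimating
  \<open>T\<close> and \<open>R\<close> separately would give only
  \<open>norm T / c\<^sup>2\<close>.\<close>

lemma norm_T_R_le: "norm (T (R x)) \<le> norm x / c"
proof (cases "T (R x) = 0")
  case False
  have "(norm (T (R x)))\<^sup>2 = X.rip x (R x)" by (simp only: S_R rip_S[symmetric])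
  also have "\<dots> \<le> norm x * norm (R x)" using X.abs_rip_le[of x "R x"] by linarith
  also have "\<dots> \<le> norm x * (norm (T (R x)) / c)"
    using below[of "R x"] c_pos by (intro mult_left_mono) (simp_all add: field_simps)
  finally have "norm (T (R x)) * norm (T (R x)) \<le> norm (T (R x)) * (norm x / c)"
    by (simp add: power2_eq_square ac_simps)
  then show ?thesis by (rule mult_left_le_imp_le) (use False in simp)
qed (use c_pos in simp)

text \<open>\<open>T R T\<^sup>*\<close> is the orthogonal projection onto the range of \<open>T\<close>.\<close>

lemma norm_range_proj_le: "norm (T (R (adj X Y T y))) \<le> norm y"
proof (cases "T (R (adj X Y T y)) = 0")
  case False
  let ?q = "T (R (adj X Y T y))"
  \<comment> \<open>Since \<open>T* T R = 1\<close>, the vector \<open>?q\<close> has the same inner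
    product with \<open>y\<close> as with itself.\<close>
  have "ip Y ?q ?q = ip Y ?q y" by (simp add: ip_adj[OF T] adj_T_R)
  then have "(norm ?q)\<^sup>2 = norm (ip Y ?q y)" by (metis Y.ip_self norm_of_real abs_power2)
  also have "\<dots> \<le> norm ?q * norm y" by (rule Y.norm_ip_le)
  finally show ?thesis using False by (simp add: power2_eq_square)
qed simp

end

section \<open>The inner product on square-summable sequences\<close>

lemma ell2_sq_summable: "(\<lambda>i. (norm (seq f i))\<^sup>2) summable_on A"
  using seq[of f] by (auto intro: summable_on_subset)

lemma norm_ell2_sq: "(norm f)\<^sup>2 = (\<Sum>\<^sub>\<infinity>i. (norm (seq f i))\<^sup>2)"
  by (simp add: norm_ell2.rep_eq infsum_nonneg)

lemma ell2_eqI: "(\<And>i. seq f i = seq g i) \<Longrightarrow> f = g"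
  by (simp add: seq_inject[symmetric] fun_eq_iff)

text \<open>The orthogonal projection onto \<open>ell2_on I\<close>; for finite index sets it also
  gives the partial sums of the coordinate expansion.\<close>

lift_definition ell2_restrict :: "nat set \<Rightarrow> 'k::real_normed_vector ell2 \<Rightarrow> 'k ell2" is
  "\<lambda>I f i. if i \<in> I then f i else 0"
  by (erule summable_on_comparison_test) auto

lift_definition ell2_single :: "nat \<Rightarrow> 'k::real_normed_vector \<Rightarrow> 'k ell2" is
  "\<lambda>i k j. if j = i then k else 0"
  subgoal for i k
    by (subst summable_on_cong_neutral[where T = "{i}" and g = "\<lambda>_. (norm k)\<^sup>2"]) auto
  done

lemma ell2_restrict_in: "ell2_restrict I f \<in> ell2_on I"
  by (simp add: ell2_on_def ell2_restrict.rep_eq)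

lemma ell2_restrict_id: "f \<in> ell2_on I \<Longrightarrow> ell2_restrict I f = f"
  by (rule ell2_eqI) (auto simp: ell2_on_def ell2_restrict.rep_eq)

lemma norm_ell2_restrict_split:
  "(norm f)\<^sup>2 = (norm (ell2_restrict I f))\<^sup>2 + (norm (f - ell2_restrict I f))\<^sup>2"
  unfolding norm_ell2_sq
  by (subst infsum_add[OF ell2_sq_summable ell2_sq_summable, symmetric])
    (auto intro!: infsum_cong simp: ell2_restrict.rep_eq minus_ell2.rep_eq)

lemma norm_ell2_restrict_le: "norm (ell2_restrict I f) \<le> norm f"
  by (rule power2_le_imp_le) (simp_all add: norm_ell2_restrict_split[of f I])

lemma norm_ell2_restrict_sq:
  "(norm (ell2_restrict I f))\<^sup>2 = (\<Sum>\<^sub>\<infinity>i\<in>I. (norm (seq f i))\<^sup>2)"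
  unfolding norm_ell2_sq by (rule infsum_cong_neutral) (auto simp: ell2_restrict.rep_eq)

lemma bounded_linear_ell2_restrict: "bounded_linear (ell2_restrict I)"
  by (rule bounded_linear_intro[where K = 1])
    (auto intro!: ell2_eqI
      simp: ell2_restrict.rep_eq plus_ell2.rep_eq scaleR_ell2.rep_eq norm_ell2_restrict_le)

lemma sum_ell2_single:
  assumes "finite F"
  shows "(\<Sum>i\<in>F. ell2_single i (seq f i)) = ell2_restrict F f"
  using assms
proof (induction F)
  case empty
  show ?case by (rule ell2_eqI) (simp add: ell2_restrict.rep_eq zero_ell2.rep_eq)
next
  case (insert j F)
  then show ?case
    by (auto intro!: ell2_eqI simp: ell2_restrict.rep_eq ell2_single.rep_eq plus_ell2.rep_eq)
qed

text \<open>Finite partial sums are restrictions, so by Pythagoras the squared error is the tail of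
  the convergent series of squared norms.\<close>

lemma has_sum_ell2_single: "((\<lambda>i. ell2_single i (seq f i)) has_sum f) UNIV"
proof -
  let ?s = "\<lambda>F. \<Sum>i\<in>F. ell2_single i (seq f i)"
  have "((\<lambda>F. \<Sum>i\<in>F. (norm (seq f i))\<^sup>2) \<longlongrightarrow> (norm f)\<^sup>2) (finite_subsets_at_top UNIV)"
    unfolding norm_ell2_sq by (rule infsum_tendsto[OF ell2_sq_summable])
  then have "((\<lambda>F. sqrt ((norm f)\<^sup>2 - (\<Sum>i\<in>F. (norm (seq f i))\<^sup>2))) \<longlongrightarrow> sqrt ((norm f)\<^sup>2 - (norm f)\<^sup>2))
      (finite_subsets_at_top UNIV)"
    by (intro tendsto_intros)
  moreover have "sqrt ((norm f)\<^sup>2 - (\<Sum>i\<in>F. (norm (seq f i))\<^sup>2)) = norm (?s F - f)" if "finite F" for F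
    using norm_ell2_restrict_split[of f F] norm_ell2_restrict_sq[of F f] that
    by (simp add: sum_ell2_single norm_minus_commute)
  then have "\<forall>\<^sub>F F in finite_subsets_at_top UNIV.
      sqrt ((norm f)\<^sup>2 - (\<Sum>i\<in>F. (norm (seq f i))\<^sup>2)) = norm (?s F - f)"
    by (intro eventually_finite_subsets_at_top_weakI) simp
  ultimately have "((\<lambda>F. norm (?s F - f)) \<longlongrightarrow> 0) (finite_subsets_at_top UNIV)"
    by (simp add: tendsto_cong)
  then show ?thesis
    unfolding has_sum_def by (simp add: tendsto_norm_zero_iff LIM_zero_iff)
qed

context pre_hilbert
begin

text \<open>Coordinatewise Cauchy-Schwarz dominates the terms by a summable series; absolute
  convergence suffices because the scalars are complete.\<close>

lemma ell2_ip_summable: "(\<lambda>i. ip H (seq f i) (seq g i)) summable_on A"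
proof (rule abs_summable_summable, rule Infinite_Sum.abs_summable_on_comparison_test')
  show "(\<lambda>i. (norm (seq f i))\<^sup>2 + (norm (seq g i))\<^sup>2) summable_on A"
    by (intro summable_on_add ell2_sq_summable)
  show "norm (ip H (seq f i) (seq g i)) \<le> (norm (seq f i))\<^sup>2 + (norm (seq g i))\<^sup>2" for i
  proof -
    have "2 * (norm (seq f i) * norm (seq g i)) \<le> (norm (seq f i))\<^sup>2 + (norm (seq g i))\<^sup>2"
      using sum_squares_bound[of "norm (seq f i)" "norm (seq g i)"] by (simp add: mult.assoc)
    then show ?thesis
      using norm_ip_le[of "seq f i" "seq g i"] norm_ge_zero[of "ip H (seq f i) (seq g i)"] by linarith
  qed
qed

lemma seq_scl_ell2: "seq (scl (ell2 H) c f) i = scl H c (seq f i)"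
proof -
  have "(\<lambda>i. (norm (scl H c (seq f i)))\<^sup>2) summable_on UNIV"
    by (simp add: norm_scl power_mult_distrib summable_on_cmult_right ell2_sq_summable)
  then show ?thesis by (simp add: ell2_def Abs_ell2_inverse)
qed

lemma ip_ell2: "ip (ell2 H) f g = (\<Sum>\<^sub>\<infinity>i. ip H (seq f i) (seq g i))"
  by (simp add: ell2_def)

lemma pre_hilbert_ell2: "pre_hilbert (ell2 H)"
proof
  fix a b :: 'f and x y z :: "'a ell2" and r :: real
  show "scl (ell2 H) a (x + y) = scl (ell2 H) a x + scl (ell2 H) a y"
    by (rule ell2_eqI) (simp add: seq_scl_ell2 plus_ell2.rep_eq scale_right_distrib)
  show "scl (ell2 H) (a + b) x = scl (ell2 H) a x + scl (ell2 H) b x"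
    by (rule ell2_eqI) (simp add: seq_scl_ell2 plus_ell2.rep_eq scale_left_distrib)
  show "scl (ell2 H) a (scl (ell2 H) b x) = scl (ell2 H) (a * b) x"
    by (rule ell2_eqI) (simp add: seq_scl_ell2)
  show "scl (ell2 H) 1 x = x"
    by (rule ell2_eqI) (simp add: seq_scl_ell2)
  show "scl (ell2 H) (of_real r) x = r *\<^sub>R x"
    by (rule ell2_eqI) (simp add: seq_scl_ell2 scaleR_ell2.rep_eq scl_of_real)
  show "ip (ell2 H) (x + y) z = ip (ell2 H) x z + ip (ell2 H) y z"
    by (simp add: ip_ell2 plus_ell2.rep_eq ip_add infsum_add ell2_ip_summable)
  show "ip (ell2 H) (scl (ell2 H) a x) y = a * ip (ell2 H) x y"
    by (simp add: ip_ell2 seq_scl_ell2 ip_scl infsum_cmult_right')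
  \<comment> \<open>Conjugation is real-linear and bounded, so it may be moved through the infinite
    sum.\<close>
  have "bounded_linear (conjugate :: 'f \<Rightarrow> 'f)"
    by (rule bounded_linear_intro[where K = 1])
      (simp_all add: conjugate_add conjugate_mult scaleR_conv_of_real)
  from has_sum_bounded_linear[OF this has_sum_infsum[OF ell2_ip_summable]]
  show "ip (ell2 H) y x = conjugate (ip (ell2 H) x y)"
    unfolding ip_ell2 by (intro infsumI) (simp add: ip_conjugate[of "seq y _"])
  have "((\<lambda>i. of_real ((norm (seq x i))\<^sup>2) :: 'f) has_sum of_real ((norm x)\<^sup>2)) UNIV"
    unfolding norm_ell2_sq by (intro has_sum_of_real has_sum_infsum ell2_sq_summable)
  then show "ip (ell2 H) x x = of_real ((norm x)\<^sup>2)"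
    by (simp only: ip_ell2 ip_self infsumI)
qed

lemma ip_ell2_single: "ip (ell2 H) f (ell2_single i k) = ip H (seq f i) k"
proof -
  have "ip (ell2 H) f (ell2_single i k) = (\<Sum>\<^sub>\<infinity>j\<in>{i}. ip H (seq f j) k)"
    unfolding ip_ell2 by (rule infsum_cong_neutral) (auto simp: ell2_single.rep_eq)
  then show ?thesis by simp
qed

lemma ip_ell2_restrict:
  assumes "g \<in> ell2_on I"
  shows "ip (ell2 H) (ell2_restrict I f) g = ip (ell2 H) f g"
    and "ip (ell2 H) g (ell2_restrict I f) = ip (ell2 H) g f"
  unfolding ip_ell2 using assms
  by (auto intro!: infsum_cong simp: ell2_on_def ell2_restrict.rep_eq)

end

section \<open>Operator-valued sequences and their duals\<close>

lemma ell2_on_add: "f \<in> ell2_on I \<Longrightarrow> g \<in> ell2_on I \<Longrightarrow> f + g \<in> ell2_on I"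
  and ell2_on_diff: "f \<in> ell2_on I \<Longrightarrow> g \<in> ell2_on I \<Longrightarrow> f - g \<in> ell2_on I"
  by (simp_all add: ell2_on_def plus_ell2.rep_eq minus_ell2.rep_eq)

lemma norm_blinfun_diff_le:
  fixes T U :: "'a::real_normed_vector \<Rightarrow>\<^sub>L 'b::real_normed_vector"
  shows "norm (T x - U x) \<le> norm (T - U) * norm x"
  using norm_blinfun[of "T - U" x] by (simp add: blinfun.diff_left)

locale operator_sequences = hilbert_pair H K
  for H :: "('f::rc_field, 'h::banach) hilbert" and K :: "('f, 'k::real_normed_vector) hilbert"

sublocale operator_sequences \<subseteq> ell: hilbert_pair H "ell2 K"
  by (intro hilbert_pair.intro X.hilbert_space_axioms Y.pre_hilbert_ell2)

context operator_sequences
begin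

lemma analysis_in_bops:
  assumes A: "bessel_seq H K I A"
  shows "analysis_op I A \<in> bops H (ell2 K)"
proof -
  have "analysis_op I A (scl H c x) = scl (ell2 K) c (analysis_op I A x)" for c x
    using A by (intro ell2_eqI)
      (simp add: bessel_seq_analysis_op[OF A] Y.seq_scl_ell2, simp add: bessel_seq_def bops_def)
  then show ?thesis by (simp add: bops_def)
qed

lemma analysis_in_ell2_on:
  assumes "bessel_seq H K I A"
  shows "analysis_op I A x \<in> ell2_on I"
  by (simp add: ell2_on_def bessel_seq_analysis_op[OF assms])

lemma norm_analysis_sq:
  assumes A: "bessel_seq H K I A"
  shows "(norm (analysis_op I A x))\<^sup>2 = (\<Sum>\<^sub>\<infinity>i\<in>I. (norm (A i x))\<^sup>2)"
  unfolding norm_ell2_sq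
  by (rule infsum_cong_neutral) (auto simp: bessel_seq_analysis_op[OF A])

lemma ip_analysis:
  assumes A: "bessel_seq H K I A"
  shows "ip (ell2 K) (analysis_op I A x) f = ip H x (synthesis_op H K I A f)"
  unfolding synthesis_op_def by (rule ell.ip_adj[OF analysis_in_bops[OF A]])

lemma synthesis_single:
  assumes A: "bessel_seq H K I A"
  shows "synthesis_op H K I A (ell2_single i k) = (if i \<in> I then adj H K (A i) k else 0)"
proof (rule X.eq_if_ip_eq)
  fix x
  have "A i \<in> bops H K" if "i \<in> I" using A that by (simp add: bessel_seq_def)
  then show "ip H x (synthesis_op H K I A (ell2_single i k))
      = ip H x (if i \<in> I then adj H K (A i) k else 0)"
    by (simp add: ip_analysis[OF A, symmetric] Y.ip_ell2_single bessel_seq_analysis_op[OF A] ip_adj)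
qed

text \<open>The continuous operator \<open>T*\<close> is applied termwise to the coordinate
  expansion of \<open>f\<close>; the terms outside \<open>I\<close> vanish.\<close>

lemma synthesis_has_sum:
  assumes A: "bessel_seq H K I A"
  shows "((\<lambda>i. adj H K (A i) (seq f i)) has_sum synthesis_op H K I A f) I"
proof -
  have "((\<lambda>i. synthesis_op H K I A (ell2_single i (seq f i))) has_sum synthesis_op H K I A f) UNIV"
    by (rule has_sum_bounded_linear[OF blinfun.bounded_linear_right has_sum_ell2_single])
  then show ?thesis
    by (rule has_sum_cong_neutral[THEN iffD1, rotated -1]) (auto simp: synthesis_single[OF A])
qed

lemma synthesis_restrict:
  assumes A: "bessel_seq H K I A"
  shows "synthesis_op H K I A (ell2_restrict I f) = synthesis_op H K I A f"
  by (rule X.eq_if_ip_eq)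
    (simp add: ip_analysis[OF A, symmetric] Y.ip_ell2_restrict analysis_in_ell2_on[OF A])

lemma bessel_opseq_of:
  assumes T: "T \<in> bops H (ell2 K)"
  shows "bessel_seq H K I (opseq_of T)"
  unfolding bessel_seq_def
proof (intro conjI exI[of _ "(norm T)\<^sup>2 + 1"] ballI allI)
  show "opseq_of T i \<in> bops H K" for i
    using T by (simp add: bops_def opseq_of_apply Y.seq_scl_ell2)
  show "0 < (norm T)\<^sup>2 + 1" by (simp add: add_nonneg_pos)
  fix x
  show "(\<lambda>i. (norm (opseq_of T i x))\<^sup>2) summable_on I"
    by (simp add: opseq_of_apply ell2_sq_summable)
  have "(\<Sum>\<^sub>\<infinity>i\<in>I. (norm (opseq_of T i x))\<^sup>2) = (norm (ell2_restrict I (T x)))\<^sup>2"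
    by (simp add: norm_ell2_restrict_sq opseq_of_apply)
  also have "\<dots> \<le> (norm T * norm x)\<^sup>2"
    by (intro power_mono order_trans[OF norm_ell2_restrict_le norm_blinfun]) simp
  also have "\<dots> \<le> ((norm T)\<^sup>2 + 1) * (norm x)\<^sup>2"
    by (simp add: power_mult_distrib distrib_right)
  finally show "(\<Sum>\<^sub>\<infinity>i\<in>I. (norm (opseq_of T i x))\<^sup>2) \<le> ((norm T)\<^sup>2 + 1) * (norm x)\<^sup>2" .
qed

text \<open>The series in \<open>dual_of\<close> sums to \<open>T_C* T_A x\<close>; passing to
  adjoints gives \<open>T_A* T_C = 1\<close>, the form in which duality enters the
  estimates.\<close>

lemma dual_of_iff:
  assumes A: "bessel_seq H K I A"
  shows "dual_of H K I A C \<longleftrightarrow>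
    bessel_seq H K I C \<and> (\<forall>x. synthesis_op H K I A (analysis_op I C x) = x)"
proof (cases "bessel_seq H K I C")
  case C: True
  note TA = analysis_in_bops[OF A] and TC = analysis_in_bops[OF C]
  have sum: "((\<lambda>i. adj H K (C i) (A i x)) has_sum synthesis_op H K I C (analysis_op I A x)) I" for x
    by (rule has_sum_cong[THEN iffD1, OF _ synthesis_has_sum[OF C]])
      (simp add: bessel_seq_analysis_op[OF A])
  have "((\<lambda>i. adj H K (C i) (A i x)) has_sum x) I \<longleftrightarrow> synthesis_op H K I C (analysis_op I A x) = x" for x
    using sum[of x] has_sum_unique[OF sum[of x], of x] by auto
  then have "dual_of H K I A C \<longleftrightarrow> (\<forall>x. synthesis_op H K I C (analysis_op I A x) = x)"
    by (simp add: dual_of_def C)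
  also have "\<dots> \<longleftrightarrow> (\<forall>x. synthesis_op H K I A (analysis_op I C x) = x)"
    unfolding synthesis_op_def
    by (intro iffI allI) (simp_all add: ell.adj_compose_eq_id_commute[OF TA TC]
        ell.adj_compose_eq_id_commute[OF TC TA])
  finally show ?thesis using C by simp
qed (simp add: dual_of_def)

end

text \<open>Instantiated twice in the theorem: for \<open>A\<close> with
  \<open>sqrt \<alpha>\<close> and for \<open>B\<close> with
  \<open>sqrt \<alpha> - \<mu>\<close>.\<close>

locale bounded_below_sequence = operator_sequences +
  fixes I :: "nat set" and A :: "('b, 'c) opseq" and c :: real
  assumes bessel: "bessel_seq H K I A"
    and c_pos: "0 < c" and below: "c * norm x \<le> norm (analysis_op I A x)"

sublocale bounded_below_sequence \<subseteq> T: bounded_below H "ell2 K" "analysis_op I A" c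
  by unfold_locales (fact analysis_in_bops[OF bessel] c_pos below)+

context bounded_below_sequence
begin

lemma S_eq: "T.S = frame_op H K I A"
  by (simp add: T.S_def frame_op_def synthesis_op_def)

lemma synthesis_T_R: "synthesis_op H K I A (analysis_op I A (T.R x)) = x"
  using T.adj_T_R by (simp add: synthesis_op_def)

text \<open>Reconstruction \<open>x = T* T R x\<close> exhibits \<open>x\<close> as a limit of
  finite sums from the ranges of the adjoints, which gives density of their span. The lower frame
  bound is \<open>c\<^sup>2\<close>.\<close>

lemma op_frame: "op_frame H K I A"
proof -
  obtain \<beta> where \<beta>: "0 < \<beta>" "\<And>x. (\<Sum>\<^sub>\<infinity>i\<in>I. (norm (A i x))\<^sup>2) \<le> \<beta> * (norm x)\<^sup>2"
    and A: "\<And>i. i \<in> I \<Longrightarrow> A i \<in> bops H K" "\<And>x. (\<lambda>i. (norm (A i x))\<^sup>2) summable_on I"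
    using bessel by (auto simp: bessel_seq_def)
  have "x \<in> closure (X.span (\<Union>i\<in>I. range (adj H K (A i))))" for x
  proof -
    let ?f = "analysis_op I A (T.R x)"
    have "((\<lambda>F. \<Sum>i\<in>F. adj H K (A i) (seq ?f i)) \<longlongrightarrow> x) (finite_subsets_at_top I)"
      using synthesis_has_sum[OF bessel, of ?f] by (simp add: has_sum_def synthesis_T_R)
    moreover have "\<forall>\<^sub>F F in finite_subsets_at_top I.
        (\<Sum>i\<in>F. adj H K (A i) (seq ?f i)) \<in> closure (X.span (\<Union>i\<in>I. range (adj H K (A i))))"
      by (intro eventually_finite_subsets_at_top_weakI closure_subset[THEN subsetD] X.span_sum
          X.span_base) auto
    ultimately show ?thesis
      by (intro Lim_in_closed_set[OF closed_closure]) auto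
  qed
  moreover have "c\<^sup>2 * (norm x)\<^sup>2 \<le> (\<Sum>\<^sub>\<infinity>i\<in>I. (norm (A i x))\<^sup>2)" for x
    using power_mono[OF below[of x], of 2] c_pos
    by (simp add: power_mult_distrib norm_analysis_sq[OF bessel])
  ultimately have "op_frame_bounds H K I A (c\<^sup>2) \<beta>"
    unfolding op_frame_bounds_def using c_pos \<beta> A by auto
  then show ?thesis unfolding op_frame_def by blast
qed

lemma analysis_dual:
  fixes L :: "'b \<Rightarrow>\<^sub>L 'c ell2"
  assumes "range L \<subseteq> ell2_on I"
  shows "analysis_op I (dual H K I A L) = (analysis_op I A o\<^sub>L T.R) + L"
  unfolding dual_def S_eq[symmetric]
  using assms analysis_in_ell2_on[OF bessel]
  by (intro analysis_op_opseq_of) (auto simp: blinfun.add_left intro!: ell2_on_add)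

lemma bessel_dual:
  assumes "L \<in> bops H (ell2 K)"
  shows "bessel_seq H K I (dual H K I A L)"
  unfolding dual_def S_eq[symmetric]
  by (intro bessel_opseq_of ell.bops_add T.T_R_in_bops assms)

lemma synthesis_analysis_dual:
  assumes "L \<in> dual_params H K I A"
  shows "synthesis_op H K I A (analysis_op I (dual H K I A L) x) = x"
proof -
  have "synthesis_op H K I A (L x) = 0"
    using assms blinfun_apply_blinfun_compose[of "synthesis_op H K I A" L x]
    by (simp add: dual_params_def)
  then show ?thesis
    using assms by (simp add: dual_params_def analysis_dual blinfun.add_left blinfun.add_right synthesis_T_R)
qed

lemma dual_of_dual:
  assumes "L \<in> dual_params H K I A"
  shows "dual_of H K I A (dual H K I A L)"
  using assms synthesis_analysis_dual[OF assms]
  by (simp add: dual_of_iff[OF bessel] bessel_dual dual_params_def)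

lemma norm_analysis_dual_le:
  assumes "L \<in> dual_params H K I A"
  shows "norm (analysis_op I (dual H K I A L)) \<le> 1 / c + norm L"
proof -
  have "norm (analysis_op I A o\<^sub>L T.R) \<le> 1 / c"
    using c_pos T.norm_T_R_le by (intro norm_blinfun_bound) auto
  moreover have "analysis_op I (dual H K I A L) = (analysis_op I A o\<^sub>L T.R) + L"
    using assms by (intro analysis_dual) (simp add: dual_params_def)
  ultimately show ?thesis
    using norm_triangle_ineq[of "analysis_op I A o\<^sub>L T.R" L] by simp
qed

text \<open>The formula is checked against the defining property. \<open>P f\<close> lies in the
  kernel because \<open>T* T R = 1\<close>; \<open>f - P f\<close> splits into a part supported
  outside \<open>I\<close> and a part in the range of \<open>T\<close>, both orthogonal to the
  kernel.\<close>

lemma orth_proj_synthesis_ker: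
  "orth_proj (ell2 K) (synthesis_ker H K I A) f
    = ell2_restrict I f - analysis_op I A (T.R (synthesis_op H K I A f))"
proof -
  let ?V = "synthesis_ker H K I A"
  define P where "P = (\<lambda>f. ell2_restrict I f - analysis_op I A (T.R (synthesis_op H K I A f)))"
  have P_in: "P f \<in> ?V" for f
    using analysis_in_ell2_on[OF bessel]
    by (simp add: synthesis_ker_def P_def ell2_on_diff ell2_restrict_in blinfun.diff_right
        synthesis_T_R synthesis_restrict[OF bessel])
  have P_orth: "ip (ell2 K) (f - P f) v = 0" if "v \<in> ?V" for f v
    using that by (simp add: P_def synthesis_ker_def ell.Y.ip_minus Y.ip_ell2_restrict ip_analysis[OF bessel])
  have unique: "p = P f" if p: "p \<in> ?V" "\<forall>v\<in>?V. ip (ell2 K) (f - p) v = 0" for p f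
  proof -
    have "p - P f \<in> ?V"
      using p(1) P_in[of f] by (simp add: synthesis_ker_def ell2_on_diff blinfun.diff_right)
    \<comment> \<open>Subtracting the two orthogonality relations makes \<open>p - P f\<close>
      orthogonal to itself.\<close>
    then have "ip (ell2 K) (f - P f) (p - P f) = 0" "ip (ell2 K) (f - p) (p - P f) = 0"
      using p(2) P_orth by blast+
    then have "ip (ell2 K) ((f - P f) - (f - p)) (p - P f) = 0"
      by (simp only: ell.Y.ip_minus[of "f - P f"]) simp
    then show ?thesis by (simp add: ell.Y.ip_self)
  qed
  have "bounded_linear (\<lambda>f. analysis_op I A (T.R (synthesis_op H K I A f)))"
    using blinfun.bounded_linear_right[of "analysis_op I A o\<^sub>L T.R o\<^sub>L synthesis_op H K I A"] by simp
  then have P: "bounded_linear P"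
    unfolding P_def by (rule bounded_linear_sub[OF bounded_linear_ell2_restrict])
  have "(THE p. p \<in> ?V \<and> (\<forall>v\<in>?V. ip (ell2 K) (f - p) v = 0)) = P f" for f
  proof (rule the_equality)
    show "P f \<in> ?V \<and> (\<forall>v\<in>?V. ip (ell2 K) (f - P f) v = 0)"
      using P_in P_orth by simp
    show "p = P f" if "p \<in> ?V \<and> (\<forall>v\<in>?V. ip (ell2 K) (f - p) v = 0)" for p
      using that by (intro unique) simp_all
  qed
  then have "orth_proj (ell2 K) ?V f = P f"
    by (simp only: orth_proj_def bounded_linear_Blinfun_apply[OF P])
  then show ?thesis by (simp only: P_def)
qed

lemma orth_proj_in_dual_params:
  assumes L: "L \<in> bops H (ell2 K)"
  shows "orth_proj (ell2 K) (synthesis_ker H K I A) o\<^sub>L L \<in> dual_params H K I A"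
    (is "?M \<in> _")
proof -
  have M: "?M x = ell2_restrict I (L x) - analysis_op I A (T.R (synthesis_op H K I A (L x)))" for x
    by (simp add: orth_proj_synthesis_ker)
  have "ell2_restrict I (scl (ell2 K) k f) = scl (ell2 K) k (ell2_restrict I f)" for k f
    by (rule ell2_eqI) (simp add: ell2_restrict.rep_eq Y.seq_scl_ell2)
  then have "?M \<in> bops H (ell2 K)"
    using L T.T ell.adj_in_bops[OF T.T] unfolding bops_def mem_Collect_eq M
    by (simp add: T.R_scl ell.Y.scale_right_diff_distrib synthesis_op_def)
  moreover have "range ?M \<subseteq> ell2_on I"
    using analysis_in_ell2_on[OF bessel] by (auto simp: orth_proj_synthesis_ker intro!: ell2_on_diff ell2_restrict_in)
  moreover have "synthesis_op H K I A o\<^sub>L ?M = 0"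
    by (rule blinfun_eqI)
      (simp add: orth_proj_synthesis_ker blinfun.diff_right synthesis_T_R synthesis_restrict[OF bessel])
  ultimately show ?thesis by (simp add: dual_params_def)
qed

text \<open>On \<open>ell2_on I\<close> the projection is \<open>1 - Q\<close>, so
  \<open>T R + (1 - Q) L - L\<close> collapses to \<open>T R (1 - T* L)\<close>. Both the optimality
  and the norm estimate start from this form.\<close>

lemma analysis_dual_proj_diff:
  fixes L :: "'b \<Rightarrow>\<^sub>L 'c ell2"
  assumes L: "L \<in> bops H (ell2 K)" and range: "range L \<subseteq> ell2_on I"
    and M: "M = orth_proj (ell2 K) (synthesis_ker H K I A) o\<^sub>L L"
  shows "(analysis_op I (dual H K I A M) - L) x
    = analysis_op I A (T.R (x - synthesis_op H K I A (L x)))"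
proof -
  have "range M \<subseteq> ell2_on I"
    using orth_proj_in_dual_params[OF L] by (simp add: M dual_params_def)
  moreover have "ell2_restrict I (L x) = L x" using range by (intro ell2_restrict_id) auto
  ultimately show ?thesis
    by (simp add: analysis_dual M blinfun.diff_left blinfun.add_left blinfun.diff_right
        orth_proj_synthesis_ker)
qed

end

section \<open>Stability of the frame property and best approximation by duals\<close>

theorem theorem4p13:
  fixes H :: "('f::rc_field, 'h::banach) hilbert"
    and K :: "('f, 'k::banach) hilbert"
    and I :: "nat set"
    and A B :: "('h, 'k) opseq"
    and \<alpha> \<beta> \<mu> :: real
  assumes "hilbert_space H" and "hilbert_space K"
    and "op_frame_bounds H K I A \<alpha> \<beta>"
    and "0 < \<mu>" and "\<mu> < sqrt \<alpha>"
    and "perturbation H K I \<mu> A B"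
  shows "op_frame H K I B \<and>
    (\<forall>L \<in> dual_params H K I A.
       let AL = dual H K I A L;
           M = orth_proj (ell2 K) (synthesis_ker H K I B) o\<^sub>L analysis_op I AL;
           BL = dual H K I B M
       in M \<in> dual_params H K I B \<and>
          dual_of H K I B BL \<and>
          (\<forall>C. dual_of H K I B C \<longrightarrow>
             norm (analysis_op I BL - analysis_op I AL) \<le> norm (analysis_op I C - analysis_op I AL)) \<and>
          perturbation H K I (\<mu> / (sqrt \<alpha> - \<mu>) * (1 / sqrt \<alpha> + norm L)) AL BL)"
proof -
  interpret H: hilbert_space H by fact
  interpret K: hilbert_space K by fact
  interpret operator_sequences H K
    by (intro operator_sequences.intro hilbert_pair.intro H.hilbert_space_axioms K.pre_hilbert_axioms)
  have bA: "bessel_seq H K I A" and bB: "bessel_seq H K I B"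
    and le_mu: "norm (analysis_op I A - analysis_op I B) \<le> \<mu>"
    using assms(6) by (simp_all add: perturbation_def)
  have \<alpha>: "0 < sqrt \<alpha>" using assms(4,5) by linarith
  have belowA: "sqrt \<alpha> * norm x \<le> norm (analysis_op I A x)" for x
  proof (rule power2_le_imp_le)
    show "(sqrt \<alpha> * norm x)\<^sup>2 \<le> (norm (analysis_op I A x))\<^sup>2"
      using assms(3) by (simp add: power_mult_distrib norm_analysis_sq[OF bA] op_frame_bounds_def)
  qed simp
  interpret A: bounded_below_sequence H K I A "sqrt \<alpha>"
    by unfold_locales (fact bA \<alpha> belowA)+
  define c where "c = sqrt \<alpha> - \<mu>"
  have c: "0 < c" using assms(5) by (simp add: c_def)
  \<comment> \<open>Reverse triangle inequality: the perturbation lowers the bound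
    \<open>sqrt \<alpha>\<close> by at most \<open>\<mu>\<close>.\<close>
  have belowB: "c * norm x \<le> norm (analysis_op I B x)" for x
  proof -
    have "norm (analysis_op I A x - analysis_op I B x) \<le> \<mu> * norm x"
      using norm_blinfun_diff_le mult_right_mono[OF le_mu norm_ge_zero] by (rule order_trans)
    then show ?thesis
      using belowA[of x] norm_triangle_ineq2[of "analysis_op I A x" "analysis_op I B x"]
      by (simp add: c_def left_diff_distrib)
  qed
  interpret B: bounded_below_sequence H K I B c
    by unfold_locales (fact bB c belowB)+
  have synthesis_diff:
    "norm (synthesis_op H K I A f - synthesis_op H K I B f) \<le> \<mu> * norm f" for f
  proof -
    have "norm (synthesis_op H K I A f - synthesis_op H K I B f)
        \<le> norm (analysis_op I A - analysis_op I B) * norm f"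
      unfolding synthesis_op_def ell.adj_diff[OF A.T.T B.T.T, symmetric]
      by (rule ell.norm_adj_le[OF ell.bops_diff[OF A.T.T B.T.T]])
    also have "\<dots> \<le> \<mu> * norm f" by (rule mult_right_mono[OF le_mu norm_ge_zero])
    finally show ?thesis .
  qed
  have main: "M \<in> dual_params H K I B \<and> dual_of H K I B BL \<and>
      (\<forall>C. dual_of H K I B C \<longrightarrow>
        norm (analysis_op I BL - analysis_op I AL) \<le> norm (analysis_op I C - analysis_op I AL)) \<and>
      perturbation H K I (\<mu> / (sqrt \<alpha> - \<mu>) * (1 / sqrt \<alpha> + norm L)) AL BL"
    if L: "L \<in> dual_params H K I A" and AL: "AL = dual H K I A L"
      and M: "M = orth_proj (ell2 K) (synthesis_ker H K I B) o\<^sub>L analysis_op I AL"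
      and BL: "BL = dual H K I B M" for L AL M BL
  proof -
    let ?TA = "analysis_op I AL" and ?TB = "analysis_op I BL"
    have bAL: "bessel_seq H K I AL"
      using L unfolding AL by (intro A.bessel_dual) (simp add: dual_params_def)
    have dual_AL: "synthesis_op H K I A (?TA x) = x" for x
      unfolding AL by (rule A.synthesis_analysis_dual[OF L])
    note TAL = analysis_in_bops[OF bAL]
    have M_in: "M \<in> dual_params H K I B"
      unfolding M by (rule B.orth_proj_in_dual_params[OF TAL])
    have dual_BL: "dual_of H K I B BL"
      unfolding BL by (rule B.dual_of_dual[OF M_in])
    have diff: "(?TB - ?TA) x = analysis_op I B (B.T.R (x - synthesis_op H K I B (?TA x)))" for x
      unfolding BL using analysis_in_ell2_on[OF bAL]
      by (intro B.analysis_dual_proj_diff[OF TAL _ M]) auto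
    have best: "norm (?TB - ?TA) \<le> norm (analysis_op I C - ?TA)" if C: "dual_of H K I B C" for C
    proof (rule norm_blinfun_bound)
      fix x
      \<comment> \<open>Replacing \<open>x\<close> by \<open>T_B* T_C x\<close> in
        \<open>diff\<close> exhibits the error as \<open>Q\<close> applied to the error of
        \<open>C\<close>, and \<open>Q\<close> does not increase norms.\<close>
      have "synthesis_op H K I B (analysis_op I C x) = x"
        using C by (simp add: dual_of_iff[OF bB])
      then have "(?TB - ?TA) x = analysis_op I B (B.T.R
          (adj H (ell2 K) (analysis_op I B) ((analysis_op I C - ?TA) x)))"
        unfolding diff by (simp add: blinfun.diff_left blinfun.diff_right synthesis_op_def)
      then show "norm ((?TB - ?TA) x) \<le> norm (analysis_op I C - ?TA) * norm x"
        by (simp only: order_trans[OF B.T.norm_range_proj_le norm_blinfun])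
    qed simp
    have "norm (?TB - ?TA) \<le> \<mu> / c * norm ?TA"
    proof (rule norm_blinfun_bound)
      fix x
      have "norm ((?TB - ?TA) x) \<le> norm (x - synthesis_op H K I B (?TA x)) / c"
        unfolding diff by (rule B.T.norm_T_R_le)
      \<comment> \<open>Here \<open>x\<close> is read as \<open>T_A* (?TA x)\<close>, so that only
        the difference of the two synthesis operators remains.\<close>
      also have "\<dots> \<le> (\<mu> * norm (?TA x)) / c"
        using synthesis_diff[of "?TA x"] c by (intro divide_right_mono) (simp_all add: dual_AL)
      also have "\<dots> \<le> (\<mu> * (norm ?TA * norm x)) / c"
        using c assms(4) by (intro divide_right_mono mult_left_mono norm_blinfun) simp_all
      finally show "norm ((?TB - ?TA) x) \<le> \<mu> / c * norm ?TA * norm x" by simp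
    qed (use c assms(4) in simp)
    also have "\<dots> \<le> \<mu> / c * (1 / sqrt \<alpha> + norm L)"
      unfolding AL using c assms(4) by (intro mult_left_mono A.norm_analysis_dual_le[OF L]) simp
    finally have "norm (?TA - ?TB) \<le> \<mu> / c * (1 / sqrt \<alpha> + norm L)"
      by (simp add: norm_minus_commute)
    \<comment> \<open>\<open>perturbation\<close> demands a strictly positive parameter;
      \<open>1 / sqrt \<alpha>\<close> provides this even for \<open>L = 0\<close>.\<close>
    moreover have "0 < \<mu> / c * (1 / sqrt \<alpha> + norm L)"
      using c assms(4) \<alpha> by (intro mult_pos_pos divide_pos_pos add_pos_nonneg) simp_all
    moreover have "bessel_seq H K I BL" using dual_BL by (simp add: dual_of_def)
    ultimately have "perturbation H K I (\<mu> / c * (1 / sqrt \<alpha> + norm L)) AL BL"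
      using bAL by (simp add: perturbation_def)
    with M_in dual_BL best show ?thesis by (simp add: c_def)
  qed
  show ?thesis
    unfolding Let_def using B.op_frame main[OF _ refl refl refl] by blast
qed

end
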